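(* The logic $\mathbf{MGrzB}$ has the finite model property; that is, every $\mathcal{L}_{\Diamond\exists}$-formula $\varphi\notin\mathbf{MGrzB}$ is refuted in some finite $\mathbf{MGrzB}$-frame.
   Context: $\mathcal{L}_{\Diamond\exists}$ is the propositional language with two modalities $\Diamond,\exists$, with $\Box=\neg\Diamond\neg$ and $\forall=\neg\exists\neg$. $\mathbf{Grz}=\mathbf{K}+\Box(\Box(p\to\Box p)\to p)\to p$ (in modality $\Diamond$), and $\mathbf{S5}$ is formulated in modality $\exists$. The fusion $\mathbf{Grz}\otimes\mathbf{S5}$ is the least set of $\mathcal{L}_{\Diamond\exists}$-formulae containing the theorems of $\mathbf{Grz}$ and of $\mathbf{S5}$ and closed under Modus Ponens, Substitution, $\Box$-necessitation, and $\forall$-necessitation. $\mathbf{MGrzB}=(\mathbf{Grz}\otimes\mathbf{S5})+(\exists\Diamond p\to\Diamond\exists p)+(\Diamond\exists p\to\exists\Diamond p)$, the least extension containing these two formulae and closed under the same rules. A 2-frame is $(X,R,E)$ with $R$ a binary relation (interpreting $\Diamond$) and $E$ an equivalence relation (interpreting $\exists$) on $X$. For a logic $\mathbf{M}$, an $\mathbf{M}$-frame is a 2-frame validating all formulae of $\mathbf{M}$. A formula is refuted in a frame if it is false at some point under some valuation. *)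

theory Defs
  imports Main
begin

datatype modality = MDia | MEx

datatype fm = Var nat | Bot | Imp fm fm | Poss modality fm

abbreviation Neg :: "fm \<Rightarrow> fm" where "Neg \<phi> \<equiv> Imp \<phi> Bot"
abbreviation Conj :: "fm \<Rightarrow> fm \<Rightarrow> fm" where "Conj \<phi> \<psi> \<equiv> Neg (Imp \<phi> (Neg \<psi>))"
abbreviation Iff :: "fm \<Rightarrow> fm \<Rightarrow> fm" where "Iff \<phi> \<psi> \<equiv> Conj (Imp \<phi> \<psi>) (Imp \<psi> \<phi>)"
abbreviation Nec :: "modality \<Rightarrow> fm \<Rightarrow> fm" where "Nec m \<phi> \<equiv> Neg (Poss m (Neg \<phi>))"

abbreviation Dia :: "fm \<Rightarrow> fm" where "Dia \<equiv> Poss MDia"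
abbreviation Box :: "fm \<Rightarrow> fm" where "Box \<equiv> Nec MDia"
abbreviation Exists :: "fm \<Rightarrow> fm" where "Exists \<equiv> Poss MEx"
abbreviation Forall :: "fm \<Rightarrow> fm" where "Forall \<equiv> Nec MEx"

fun subst :: "(nat \<Rightarrow> fm) \<Rightarrow> fm \<Rightarrow> fm" where
  "subst \<sigma> (Var n) = \<sigma> n"
| "subst \<sigma> Bot = Bot"
| "subst \<sigma> (Imp \<phi> \<psi>) = Imp (subst \<sigma> \<phi>) (subst \<sigma> \<psi>)"
| "subst \<sigma> (Poss m \<phi>) = Poss m (subst \<sigma> \<phi>)"

text \<open>The formulae whose modalities all belong to \<open>M\<close>: the unimodal languages are
  \<open>lang {MDia}\<close> and \<open>lang {MEx}\<close>, the bimodal one is \<open>lang UNIV\<close>.\<close>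
inductive_set lang :: "modality set \<Rightarrow> fm set" for M where
  "Var n \<in> lang M"
| "Bot \<in> lang M"
| "\<phi> \<in> lang M \<Longrightarrow> \<psi> \<in> lang M \<Longrightarrow> Imp \<phi> \<psi> \<in> lang M"
| "m \<in> M \<Longrightarrow> \<phi> \<in> lang M \<Longrightarrow> Poss m \<phi> \<in> lang M"

text \<open>Propositional tautologies: variables and formulae \<open>Poss m \<phi>\<close> count as atoms.\<close>
fun prop_eval :: "(fm \<Rightarrow> bool) \<Rightarrow> fm \<Rightarrow> bool" where
  "prop_eval v (Var n) = v (Var n)"
| "prop_eval v Bot = False"
| "prop_eval v (Imp \<phi> \<psi>) = (prop_eval v \<phi> \<longrightarrow> prop_eval v \<psi>)"
| "prop_eval v (Poss m \<phi>) = v (Poss m \<phi>)"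

definition tautology :: "fm \<Rightarrow> bool" where
  "tautology \<phi> \<longleftrightarrow> (\<forall>v. prop_eval v \<phi>)"

text \<open>The closure of \<open>\<Gamma>\<close>, within the language \<open>lang M\<close>, under Modus Ponens, Substitution
  and necessitation for every modality in \<open>M\<close>.\<close>
inductive_set logic_closure :: "modality set \<Rightarrow> fm set \<Rightarrow> fm set" for M \<Gamma> where
  base: "\<phi> \<in> \<Gamma> \<Longrightarrow> \<phi> \<in> logic_closure M \<Gamma>"
| mp: "Imp \<phi> \<psi> \<in> logic_closure M \<Gamma> \<Longrightarrow> \<phi> \<in> logic_closure M \<Gamma> \<Longrightarrow> \<psi> \<in> logic_closure M \<Gamma>"
| substitution: "\<phi> \<in> logic_closure M \<Gamma> \<Longrightarrow> (\<And>n. \<sigma> n \<in> lang M) \<Longrightarrow> subst \<sigma> \<phi> \<in> logic_closure M \<Gamma>"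
| necessitation: "\<phi> \<in> logic_closure M \<Gamma> \<Longrightarrow> m \<in> M \<Longrightarrow> Nec m \<phi> \<in> logic_closure M \<Gamma>"

abbreviation var_p :: fm where "var_p \<equiv> Var 0"
abbreviation var_q :: fm where "var_q \<equiv> Var 1"

text \<open>The unimodal logic \<open>K\<close> in modality \<open>m\<close>. As \<open>Poss\<close> is the primitive operator,
  the distribution axiom for \<open>Nec\<close> has to be complemented by the duality axiom.\<close>
definition K_logic :: "modality \<Rightarrow> fm set" where
  "K_logic m = logic_closure {m}
     ({\<phi> \<in> lang {m}. tautology \<phi>} \<union>
      {Imp (Nec m (Imp var_p var_q)) (Imp (Nec m var_p) (Nec m var_q)),
       Iff (Poss m var_p) (Neg (Nec m (Neg var_p)))})"

definition Grz :: "fm set" where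
  "Grz = logic_closure {MDia} (K_logic MDia \<union> {Imp (Box (Imp (Box (Imp var_p (Box var_p))) var_p)) var_p})"

definition S5 :: "fm set" where
  "S5 = logic_closure {MEx}
     (K_logic MEx \<union> {Imp (Forall var_p) var_p, Imp (Forall var_p) (Forall (Forall var_p)), Imp (Exists var_p) (Forall (Exists var_p))})"

definition Grz_S5_fusion :: "fm set" where
  "Grz_S5_fusion = logic_closure UNIV (Grz \<union> S5)"

definition MGrzB :: "fm set" where
  "MGrzB = logic_closure UNIV
     (Grz_S5_fusion \<union> {Imp (Exists (Dia var_p)) (Dia (Exists var_p)), Imp (Dia (Exists var_p)) (Exists (Dia var_p))})"

definition two_frame :: "'w set \<Rightarrow> 'w rel \<Rightarrow> 'w rel \<Rightarrow> bool" where
  "two_frame X R E \<longleftrightarrow> X \<noteq> {} \<and> R \<subseteq> X \<times> X \<and> equiv X E"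

fun acc :: "'w rel \<Rightarrow> 'w rel \<Rightarrow> modality \<Rightarrow> 'w rel" where
  "acc R E MDia = R"
| "acc R E MEx = E"

fun sat :: "'w rel \<Rightarrow> 'w rel \<Rightarrow> (nat \<Rightarrow> 'w set) \<Rightarrow> 'w \<Rightarrow> fm \<Rightarrow> bool" where
  "sat R E V x (Var n) = (x \<in> V n)"
| "sat R E V x Bot = False"
| "sat R E V x (Imp \<phi> \<psi>) = (sat R E V x \<phi> \<longrightarrow> sat R E V x \<psi>)"
| "sat R E V x (Poss m \<phi>) = (\<exists>y. (x, y) \<in> acc R E m \<and> sat R E V y \<phi>)"

definition refuted :: "'w set \<Rightarrow> 'w rel \<Rightarrow> 'w rel \<Rightarrow> fm \<Rightarrow> bool" where
  "refuted X R E \<phi> \<longleftrightarrow> (\<exists>V x. (\<forall>n. V n \<subseteq> X) \<and> x \<in> X \<and> \<not> sat R E V x \<phi>)"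

definition valid_in :: "'w set \<Rightarrow> 'w rel \<Rightarrow> 'w rel \<Rightarrow> fm \<Rightarrow> bool" where
  "valid_in X R E \<phi> \<longleftrightarrow> (\<forall>V x. (\<forall>n. V n \<subseteq> X) \<longrightarrow> x \<in> X \<longrightarrow> sat R E V x \<phi>)"

definition logic_frame :: "fm set \<Rightarrow> 'w set \<Rightarrow> 'w rel \<Rightarrow> 'w rel \<Rightarrow> bool" where
  "logic_frame L X R E \<longleftrightarrow> two_frame X R E \<and> (\<forall>\<phi>\<in>L. valid_in X R E \<phi>)"

text \<open>Points may be taken to be natural numbers, since every finite frame is isomorphic to
  one of this kind.\<close>
definition finite_model_property :: "fm set \<Rightarrow> bool" where
  "finite_model_property L \<longleftrightarrow>
     (\<forall>\<phi>. \<phi> \<notin> L \<longrightarrow>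
        (\<exists>(X :: nat set) R E. finite X \<and> logic_frame L X R E \<and> refuted X R E \<phi>))"

end

theory Submission
  imports Defs "HOL-Library.Countable"
begin

text \<open>
  In the canonical model of \<open>MGrzB\<close> the relation \<open>R\<close> is a preorder, \<open>E\<close> is an equivalence and the
  two commute. Fix the finite set \<open>\<Sigma>\<close> of subformulae of the refuted formula; a point has a type, its
  intersection with \<open>\<Sigma>\<close>, and an \<open>E\<close>-class has as class type the set of types of its points. The
  Grz axiom holds for every definable set, in particular for the set of points with a given
  class type \<open>\<beta>\<close>. Hence there is, for each realised \<open>\<beta>\<close>, a class \<open>C\<close> of type \<open>\<beta>\<close> above
  which \<open>\<beta>\<close> is never left and met again, and which sees as few class types as possible. All classes
  above \<open>C\<close> have type \<open>\<beta>\<close> or a type of smaller rank (number of class types seen).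

  The finite frame has one \<open>E\<close>-class per realised \<open>\<beta>\<close>. Its points are the pairs of the type of a
  point \<open>x\<close> in the region of type \<open>\<beta>\<close> above \<open>C\<close> and the set of types that \<open>x\<close> reaches within that
  region. Between different classes one takes the largest relation under which diamonds stay
  true at predecessors, restricted to pairs of falling rank where it is total in both directions,
  which is what commutation requires. Within a class, a proper step must shrink the set of reachable
  types. This is a partial order, and the Grz axiom supplies witnesses for diamonds along it.
\<close>

section \<open>Soundness\<close>

lemma acc_subset:
  assumes "two_frame X R E"
  shows "acc R E m \<subseteq> X \<times> X"
  using assms by (cases m) (auto simp: two_frame_def equiv_def refl_on_def)

text \<open>The new valuation is cut down to \<open>X\<close> because \<open>valid_in\<close> ranges
  only over valuations inside \<open>X\<close>; successors of points of \<open>X\<close> stay in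
  \<open>X\<close>.\<close>

lemma sat_subst:
  assumes "two_frame X R E" and "x \<in> X"
  shows "sat R E V x (subst \<sigma> \<phi>) \<longleftrightarrow> sat R E (\<lambda>n. {y \<in> X. sat R E V y (\<sigma> n)}) x \<phi>"
  using assms(2)
proof (induction \<phi> arbitrary: x)
  case (Poss m \<phi>)
  have "(x, y) \<in> acc R E m \<Longrightarrow> y \<in> X" for y using acc_subset[OF assms(1), of m] by blast
  then show ?case using Poss.IH by auto
qed auto

lemma sat_prop_eval: "prop_eval (sat R E V x) \<phi> = sat R E V x \<phi>"
  by (induction \<phi>) auto

lemma valid_in_tautology: "tautology \<phi> \<Longrightarrow> valid_in X R E \<phi>"
  unfolding valid_in_def tautology_def by (metis sat_prop_eval)

lemma valid_in_logic_closure: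
  assumes F: "two_frame X R E" and \<Gamma>: "\<And>\<phi>. \<phi> \<in> \<Gamma> \<Longrightarrow> valid_in X R E \<phi>"
    and "\<phi> \<in> logic_closure M \<Gamma>"
  shows "valid_in X R E \<phi>"
  using assms(3)
proof induction
  case (mp \<phi> \<psi>)
  then show ?case by (auto simp: valid_in_def)
next
  case (substitution \<phi> \<sigma>)
  then show ?case by (auto simp: valid_in_def sat_subst[OF F])
next
  case (necessitation \<phi> m)
  have "(x, y) \<in> acc R E m \<Longrightarrow> y \<in> X" for x y using acc_subset[OF F, of m] by blast
  then show ?case using necessitation by (auto simp: valid_in_def)
qed (rule \<Gamma>)

lemma valid_in_K_logic:
  assumes "two_frame X R E" and "\<phi> \<in> K_logic m"
  shows "valid_in X R E \<phi>"
  using assms(2) unfolding K_logic_def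
proof (rule valid_in_logic_closure[OF assms(1), rotated])
  fix \<phi> assume "\<phi> \<in> {\<phi> \<in> lang {m}. tautology \<phi>} \<union>
      {Imp (Nec m (Imp var_p var_q)) (Imp (Nec m var_p) (Nec m var_q)),
       Iff (Poss m var_p) (Neg (Nec m (Neg var_p)))}"
  then show "valid_in X R E \<phi>"
    by (auto dest: valid_in_tautology) (auto simp: valid_in_def)
qed

text \<open>A failure of the axiom at \<open>x\<close> forces every successor of \<open>x\<close>
  outside \<open>V 0\<close> to see a point of \<open>V 0\<close> and, beyond it, another point
  outside \<open>V 0\<close>. By antisymmetry the latter is strictly higher, so no such successor
  can have the fewest successors, against finiteness.\<close>

lemma valid_in_Grz:
  assumes F: "two_frame X R E" and fin: "finite X"
    and po: "refl_on X R" "trans R" "antisym R" and "\<phi> \<in> Grz"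
  shows "valid_in X R E \<phi>"
  using \<open>\<phi> \<in> Grz\<close> unfolding Grz_def
proof (rule valid_in_logic_closure[OF F, rotated])
  let ?grz = "Imp (Box (Imp (Box (Imp var_p (Box var_p))) var_p)) var_p"
  have RX: "R \<subseteq> X \<times> X" using F by (auto simp: two_frame_def)
  have "valid_in X R E ?grz"
    unfolding valid_in_def
  proof (intro allI impI)
    fix V x assume x: "x \<in> X"
    show "sat R E V x ?grz"
    proof (rule ccontr)
      assume neg: "\<not> sat R E V x ?grz"
      then have hyp: "\<And>y. (x, y) \<in> R \<Longrightarrow> y \<notin> V 0 \<Longrightarrow> \<exists>z w. (y, z) \<in> R \<and> z \<in> V 0 \<and> (z, w) \<in> R \<and> w \<notin> V 0"
        and xV: "x \<notin> V 0"
        by auto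
      have "(x, x) \<in> R \<and> x \<notin> V 0" using xV x po(1) by (auto simp: refl_on_def)
      then obtain y where y: "(x, y) \<in> R" "y \<notin> V 0"
        and least: "\<And>w. (x, w) \<in> R \<and> w \<notin> V 0 \<Longrightarrow> card (R `` {y}) \<le> card (R `` {w})"
        using ex_has_least_nat[of "\<lambda>y. (x, y) \<in> R \<and> y \<notin> V 0" x "\<lambda>y. card (R `` {y})"] by blast
      obtain z w where zw: "(y, z) \<in> R" "z \<in> V 0" "(z, w) \<in> R" "w \<notin> V 0"
        using hyp[OF y] by blast
      have yw: "(y, w) \<in> R" using zw po(2) by (meson transD)
      have "w \<noteq> y" using zw y(2) po(3) by (metis antisymD)
      then have "y \<notin> R `` {w}" using yw po(3) by (auto dest: antisymD)
      moreover have "R `` {w} \<subseteq> R `` {y}" using yw po(2) by (auto dest: transD)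
      moreover have "y \<in> R `` {y}" using yw RX po(1) by (auto simp: refl_on_def)
      moreover have "finite (R `` {y})" 
        using fin RX by (auto intro: finite_subset[of _ X])
      ultimately have "card (R `` {w}) < card (R `` {y})"
        by (metis psubsetI psubset_card_mono)
      moreover have "(x, w) \<in> R" using y(1) yw po(2) by (meson transD)
      ultimately show False using least[of w] zw(4) by auto
    qed
  qed
  then show "\<And>\<phi>. \<phi> \<in> K_logic MDia \<union> {?grz} \<Longrightarrow> valid_in X R E \<phi>"
    using valid_in_K_logic[OF F] by blast
qed

lemma valid_in_S5:
  assumes F: "two_frame X R E" and "\<phi> \<in> S5"
  shows "valid_in X R E \<phi>"
  using \<open>\<phi> \<in> S5\<close> unfolding S5_def
proof (rule valid_in_logic_closure[OF F, rotated])
  have E: "refl_on X E" "sym E" "trans E" using F by (auto simp: two_frame_def equiv_def)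
  have 1: "valid_in X R E (Imp (Forall var_p) var_p)"
    using E(1) by (auto simp: valid_in_def refl_on_def)
  have 2: "valid_in X R E (Imp (Forall var_p) (Forall (Forall var_p)))"
    using E(3) unfolding valid_in_def by simp (meson transD)
  have 3: "valid_in X R E (Imp (Exists var_p) (Forall (Exists var_p)))"
    using E(2,3) unfolding valid_in_def by simp (meson transD symD)
  show "\<And>\<phi>. \<phi> \<in> K_logic MEx \<union> {Imp (Forall var_p) var_p, Imp (Forall var_p) (Forall (Forall var_p)),
      Imp (Exists var_p) (Forall (Exists var_p))} \<Longrightarrow> valid_in X R E \<phi>"
    using 1 2 3 valid_in_K_logic[OF F] by blast
qed

text \<open>Each axiom added to the fusion corresponds to one inclusion of
  \<open>E O R = R O E\<close>, where \<open>O\<close> composes from left to right.\<close>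

lemma logic_frame_MGrzB:
  assumes F: "two_frame X R E" and "finite X"
    and po: "refl_on X R" "trans R" "antisym R" and comm: "E O R = R O E"
  shows "logic_frame MGrzB X R E"
proof -
  have "valid_in X R E \<phi>" if "\<phi> \<in> Grz_S5_fusion" for \<phi>
    using that unfolding Grz_S5_fusion_def
    by (rule valid_in_logic_closure[OF F, rotated])
      (use valid_in_Grz[OF assms(1-5)] valid_in_S5[OF F] in blast)
  moreover have "\<exists>u. (x, u) \<in> R \<and> (u, z) \<in> E" if "(x, y) \<in> E" "(y, z) \<in> R" for x y z
    using relcompI[OF that] unfolding comm by blast
  then have "valid_in X R E (Imp (Exists (Dia var_p)) (Dia (Exists var_p)))"
    unfolding valid_in_def by simp meson
  moreover have "\<exists>u. (x, u) \<in> E \<and> (u, z) \<in> R" if "(x, y) \<in> R" "(y, z) \<in> E" for x y z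
    using relcompI[OF that] unfolding comm[symmetric] by blast
  then have "valid_in X R E (Imp (Dia (Exists var_p)) (Exists (Dia var_p)))"
    unfolding valid_in_def by simp meson
  ultimately have "valid_in X R E \<phi>" if "\<phi> \<in> MGrzB" for \<phi>
    using that unfolding MGrzB_def
    by (rule_tac valid_in_logic_closure[OF F, rotated]) blast+
  then show ?thesis using F by (simp add: logic_frame_def)
qed

section \<open>Renaming points\<close>

lemma map_prod_image_iff:
  assumes "inj_on f X" and "S \<subseteq> X \<times> X" and "x \<in> X"
  shows "(f x, z) \<in> map_prod f f ` S \<longleftrightarrow> (\<exists>y\<in>X. (x, y) \<in> S \<and> z = f y)"
proof
  assume "(f x, z) \<in> map_prod f f ` S"
  then obtain x' y where *: "(x', y) \<in> S" "f x = f x'" "z = f y" by auto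
  then have "x = x'" using assms by (auto dest: inj_onD)
  then show "\<exists>y\<in>X. (x, y) \<in> S \<and> z = f y" using * assms by blast
qed auto

text \<open>Intersecting with \<open>X\<close> matters: \<open>f\<close> is injective only there,
  and a point of \<open>V n\<close> outside \<open>X\<close> could share its image with
  \<open>x\<close>.\<close>

lemma sat_rename:
  assumes F: "two_frame X R E" and inj: "inj_on f X" and "x \<in> X"
  shows "sat (map_prod f f ` R) (map_prod f f ` E) (\<lambda>n. f ` (V n \<inter> X)) (f x) \<phi> \<longleftrightarrow> sat R E V x \<phi>"
  using \<open>x \<in> X\<close>
proof (induction \<phi> arbitrary: x)
  case (Var n)
  then show ?case using inj by (auto simp: inj_on_def)
next
  case (Poss m \<phi>)
  have "acc (map_prod f f ` R) (map_prod f f ` E) m = map_prod f f ` acc R E m"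
    by (cases m) auto
  then have "sat (map_prod f f ` R) (map_prod f f ` E) (\<lambda>n. f ` (V n \<inter> X)) (f x) (Poss m \<phi>) \<longleftrightarrow>
      (\<exists>y\<in>X. (x, y) \<in> acc R E m \<and> sat R E V y \<phi>)"
    using Poss.IH map_prod_image_iff[OF inj acc_subset[OF F] Poss.prems, of _ m] by auto
  also have "\<dots> \<longleftrightarrow> sat R E V x (Poss m \<phi>)" using acc_subset[OF F, of m] by auto
  finally show ?case .
qed auto

text \<open>The points built later are triples of sets, whereas \<open>finite_model_property\<close>
  asks for natural numbers. Order and commutation survive an injective renaming, so soundness
  applies to the image.\<close>

lemma nat_frame:
  fixes X :: "'w set"
  assumes F: "two_frame X R E" and "finite X"
    and po: "refl_on X R" "trans R" "antisym R" and comm: "E O R = R O E"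
    and ref: "refuted X R E \<phi>"
  shows "\<exists>(X' :: nat set) R' E'. finite X' \<and> logic_frame MGrzB X' R' E' \<and> refuted X' R' E' \<phi>"
proof -
  obtain f :: "'w \<Rightarrow> nat" where inj: "inj_on f X"
    using finite_imp_inj_to_nat_seg[OF \<open>finite X\<close>] by blast
  let ?r = "\<lambda>S. map_prod f f ` S"
  have RX: "R \<subseteq> X \<times> X" and EX: "E \<subseteq> X \<times> X"
    and eq: "refl_on X E" "sym E" "trans E" and "X \<noteq> {}"
    using F acc_subset[OF F, of MEx] by (auto simp: two_frame_def equiv_def)
  have trans: "trans (?r S)" if "S \<subseteq> X \<times> X" "trans S" for S
  proof (rule transI)
    fix a b c assume "(a, b) \<in> ?r S" "(b, c) \<in> ?r S"
    then obtain x y y' z where *: "(x, y) \<in> S" "(y', z) \<in> S" "f y = f y'" "a = f x" "c = f z" by auto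
    then have "y = y'" using that inj by (auto simp: inj_on_def)
    then have "(x, z) \<in> S" using * that by (meson transD)
    then show "(a, c) \<in> ?r S" using * by auto
  qed
  have comp: "?r S O ?r S' = ?r (S O S')" if "S \<subseteq> X \<times> X" "S' \<subseteq> X \<times> X" for S S'
  proof
    show "?r S O ?r S' \<subseteq> ?r (S O S')"
    proof clarify
      fix x y y' z assume *: "(x, y) \<in> S" "(y', z) \<in> S'" "f y = f y'"
      then have "y = y'" using that inj by (auto simp: inj_on_def)
      then show "(f x, f z) \<in> ?r (S O S')" using * by auto
    qed
  qed auto
  have refl: "refl_on (f ` X) (?r S)" if "S \<subseteq> X \<times> X" "refl_on X S" for S
    using that by (auto simp: refl_on_def)
  have "antisym (?r R)"
  proof (rule antisymI)
    fix a b assume ab: "(a, b) \<in> ?r R" and ba: "(b, a) \<in> ?r R"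
    obtain x y where xy: "a = f x" "b = f y" "(x, y) \<in> R" using ab by auto
    have "\<exists>z\<in>X. (y, z) \<in> R \<and> a = f z"
      using map_prod_image_iff[OF inj RX, of y a] ba xy(2) subsetD[OF RX xy(3)] by auto
    then obtain z where z: "z \<in> X" "(y, z) \<in> R" "f x = f z" using xy(1) by auto
    then have "x = z" using inj_onD[OF inj z(3) _ z(1)] subsetD[OF RX xy(3)] by auto
    then show "a = b" using antisymD[OF po(3) xy(3)] xy z by simp
  qed
  moreover have "sym (?r E)" using eq(2) by (auto simp: sym_def)
  then have F': "two_frame (f ` X) (?r R) (?r E)"
    unfolding two_frame_def equiv_def
    using RX \<open>X \<noteq> {}\<close> EX refl[OF EX eq(1)] trans[OF EX eq(3)] by auto
  moreover have "?r E O ?r R = ?r R O ?r E"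
    unfolding comp[OF RX EX] comp[OF EX RX] comm ..
  ultimately have "logic_frame MGrzB (f ` X) (?r R) (?r E)"
    using \<open>finite X\<close> refl[OF RX po(1)] trans[OF RX po(2)]
    by (rule_tac logic_frame_MGrzB) (assumption | rule finite_imageI)+
  moreover obtain V x where "x \<in> X" "\<not> sat R E V x \<phi>" using ref by (auto simp: refuted_def)
  then have "refuted (f ` X) (?r R) (?r E) \<phi>"
    unfolding refuted_def using sat_rename[OF F inj]
    by (intro exI[of _ "\<lambda>n. f ` (V n \<inter> X)"] exI[of _ "f x"]) auto
  ultimately show ?thesis using \<open>finite X\<close> by blast
qed

section \<open>The canonical model\<close>

lemma prop_eval_foldr_Imp:
  "prop_eval v (foldr Imp xs \<phi>) \<longleftrightarrow> ((\<forall>x\<in>set xs. prop_eval v x) \<longrightarrow> prop_eval v \<phi>)"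
  by (induction xs) auto

locale normal_logic =
  fixes L :: "fm set"
  assumes taut: "tautology \<phi> \<Longrightarrow> \<phi> \<in> L"
    and mp: "Imp \<phi> \<psi> \<in> L \<Longrightarrow> \<phi> \<in> L \<Longrightarrow> \<psi> \<in> L"
    and nec: "\<phi> \<in> L \<Longrightarrow> Nec m \<phi> \<in> L"
    and K: "Imp (Nec m (Imp \<phi> \<psi>)) (Imp (Nec m \<phi>) (Nec m \<psi>)) \<in> L"
    and dual: "Iff (Poss m \<phi>) (Neg (Nec m (Neg \<phi>))) \<in> L"
begin

text \<open>All propositional reasoning in \<open>L\<close> goes through this rule: the iterated
  implication is a tautology, and modus ponens strips its premises one by one.\<close>

lemma conseq:
  assumes "set xs \<subseteq> L" "\<And>v. \<forall>x\<in>set xs. prop_eval v x \<Longrightarrow> prop_eval v \<phi>"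
  shows "\<phi> \<in> L"
proof -
  have "foldr Imp xs \<phi> \<in> L"
    using assms(2) by (intro taut) (auto simp: tautology_def prop_eval_foldr_Imp)
  then show ?thesis using assms(1) by (induction xs) (auto dest: mp)
qed

definition derives :: "fm set \<Rightarrow> fm \<Rightarrow> bool" where
  "derives \<Gamma> \<phi> \<longleftrightarrow> (\<exists>xs. set xs \<subseteq> \<Gamma> \<and> foldr Imp xs \<phi> \<in> L)"

lemma derives_conseq:
  assumes "\<forall>\<psi>\<in>set ys. derives \<Gamma> \<psi>" "\<And>v. \<forall>y\<in>set ys. prop_eval v y \<Longrightarrow> prop_eval v \<phi>"
  shows "derives \<Gamma> \<phi>"
proof -
  obtain f where f: "\<And>\<psi>. \<psi> \<in> set ys \<Longrightarrow> set (f \<psi>) \<subseteq> \<Gamma> \<and> foldr Imp (f \<psi>) \<psi> \<in> L"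
    using assms(1) unfolding derives_def by metis
  have "foldr Imp (concat (map f ys)) \<phi> \<in> L"
    by (rule conseq[of "map (\<lambda>\<psi>. foldr Imp (f \<psi>) \<psi>) ys"])
      (use f assms(2) in \<open>auto simp: prop_eval_foldr_Imp\<close>)
  moreover have "set (concat (map f ys)) \<subseteq> \<Gamma>" using f by auto
  ultimately show ?thesis unfolding derives_def by blast
qed

lemma derives_member: "\<phi> \<in> \<Gamma> \<Longrightarrow> derives \<Gamma> \<phi>"
  unfolding derives_def by (rule exI[of _ "[\<phi>]"]) (auto intro!: taut simp: tautology_def)

lemma derives_theorem: "\<phi> \<in> L \<Longrightarrow> derives \<Gamma> \<phi>"
  unfolding derives_def by (rule exI[of _ "[]"]) auto

text \<open>Premises can be reordered propositionally, so those from \<open>\<Delta>\<close> can be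
  moved innermost. This gives the deduction lemma and, with a set of boxed formulae behind
  \<open>\<Gamma>\<close>, compactness for canonical successors.\<close>

lemma derives_split:
  assumes "derives (\<Gamma> \<union> \<Delta>) \<phi>"
  shows "\<exists>ds. set ds \<subseteq> \<Delta> \<and> derives \<Gamma> (foldr Imp ds \<phi>)"
proof -
  obtain xs where xs: "set xs \<subseteq> \<Gamma> \<union> \<Delta>" "foldr Imp xs \<phi> \<in> L"
    using assms by (auto simp: derives_def)
  let ?ds = "filter (\<lambda>x. x \<in> \<Delta>) xs" and ?gs = "filter (\<lambda>x. x \<notin> \<Delta>) xs"
  have "foldr Imp ?gs (foldr Imp ?ds \<phi>) \<in> L"
    by (rule conseq[of "[foldr Imp xs \<phi>]"]) (use xs in \<open>auto simp: prop_eval_foldr_Imp\<close>)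
  moreover have "set ?gs \<subseteq> \<Gamma>" "set ?ds \<subseteq> \<Delta>" using xs by auto
  ultimately show ?thesis unfolding derives_def by blast
qed

lemma deduction: "derives (insert \<psi> \<Gamma>) \<phi> \<Longrightarrow> derives \<Gamma> (Imp \<psi> \<phi>)"
proof -
  assume "derives (insert \<psi> \<Gamma>) \<phi>"
  then obtain ds where "set ds \<subseteq> {\<psi>}" "derives \<Gamma> (foldr Imp ds \<phi>)"
    using derives_split[of \<Gamma> "{\<psi>}"] by auto
  then show ?thesis
    by (intro derives_conseq[of "[foldr Imp ds \<phi>]"]) (auto simp: prop_eval_foldr_Imp)
qed

section \<open>Maximal consistent sets\<close>

definition mcs :: "fm set \<Rightarrow> bool" where
  "mcs x \<longleftrightarrow> \<not> derives x Bot \<and> (\<forall>\<phi>. \<phi> \<in> x \<or> Neg \<phi> \<in> x)"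

lemma mcs_derives:
  assumes "mcs x" "derives x \<phi>"
  shows "\<phi> \<in> x"
proof (rule ccontr)
  assume "\<phi> \<notin> x"
  then have "Neg \<phi> \<in> x" using assms by (auto simp: mcs_def)
  then have "derives x Bot"
    using assms derives_member by (intro derives_conseq[of "[\<phi>, Neg \<phi>]"]) auto
  then show False using assms by (simp add: mcs_def)
qed

lemma mcs_theorem: "mcs x \<Longrightarrow> \<phi> \<in> L \<Longrightarrow> \<phi> \<in> x"
  using mcs_derives derives_theorem by blast

lemma mcs_Bot: "mcs x \<Longrightarrow> Bot \<notin> x"
  using derives_member by (auto simp: mcs_def)

lemma mcs_Imp:
  assumes "mcs x"
  shows "Imp \<phi> \<psi> \<in> x \<longleftrightarrow> (\<phi> \<in> x \<longrightarrow> \<psi> \<in> x)"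
proof
  assume "Imp \<phi> \<psi> \<in> x"
  then show "\<phi> \<in> x \<longrightarrow> \<psi> \<in> x"
    using derives_member assms
    by (intro impI mcs_derives[OF assms] derives_conseq[of "[\<phi>, Imp \<phi> \<psi>]"]) auto
next
  assume "\<phi> \<in> x \<longrightarrow> \<psi> \<in> x"
  then consider "Neg \<phi> \<in> x" | "\<psi> \<in> x" using assms by (auto simp: mcs_def)
  then show "Imp \<phi> \<psi> \<in> x"
  proof cases
    case 1
    then show ?thesis using derives_member
      by (intro mcs_derives[OF assms] derives_conseq[of "[Neg \<phi>]"]) auto
  next
    case 2
    then show ?thesis using derives_member
      by (intro mcs_derives[OF assms] derives_conseq[of "[\<psi>]"]) auto
  qed
qed

lemma mcs_foldr_Imp:
  assumes "mcs x"
  shows "foldr Imp ds \<phi> \<in> x \<longleftrightarrow> (set ds \<subseteq> x \<longrightarrow> \<phi> \<in> x)"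
  by (induction ds) (auto simp: mcs_Imp[OF assms])

text \<open>Zorn's lemma applies because a derivation of \<open>Bot\<close> uses finitely many
  premises, all in one member of the chain. A maximal consistent set decides \<open>\<phi>\<close>,
  since otherwise \<open>deduction\<close> would derive both \<open>Neg \<phi>\<close> and
  \<open>Neg (Neg \<phi>)\<close> from it.\<close>

lemma lindenbaum:
  assumes "\<not> derives \<Gamma> Bot"
  shows "\<exists>x. mcs x \<and> \<Gamma> \<subseteq> x"
proof -
  let ?A = "{x. \<Gamma> \<subseteq> x \<and> \<not> derives x Bot}"
  have "\<exists>M\<in>?A. \<forall>x\<in>?A. M \<subseteq> x \<longrightarrow> x = M"
  proof (rule subset_Zorn_nonempty)
    show "?A \<noteq> {}" using assms by auto
  next
    fix \<C> assume \<C>: "\<C> \<noteq> {}" "subset.chain ?A \<C>"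
    have "\<not> derives (\<Union>\<C>) Bot"
    proof
      assume "derives (\<Union>\<C>) Bot"
      then obtain xs where xs: "set xs \<subseteq> \<Union>\<C>" "foldr Imp xs Bot \<in> L"
        by (auto simp: derives_def)
      obtain x where "x \<in> \<C>" "set xs \<subseteq> x"
        using finite_subset_Union_chain[OF _ xs(1) \<C>] by auto
      then show False using \<C> xs by (auto simp: derives_def subset_chain_def)
    qed
    moreover have "\<Gamma> \<subseteq> \<Union>\<C>" using \<C> unfolding subset_chain_def by blast
    ultimately show "\<Union>\<C> \<in> ?A" by simp
  qed
  then obtain M where M: "\<Gamma> \<subseteq> M" "\<not> derives M Bot"
    and max: "\<And>x. \<Gamma> \<subseteq> x \<Longrightarrow> \<not> derives x Bot \<Longrightarrow> M \<subseteq> x \<Longrightarrow> x = M"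
    by auto
  have "\<phi> \<in> M \<or> Neg \<phi> \<in> M" for \<phi>
  proof (rule ccontr)
    assume "\<not> (\<phi> \<in> M \<or> Neg \<phi> \<in> M)"
    then have "derives (insert \<phi> M) Bot" "derives (insert (Neg \<phi>) M) Bot"
      using max[of "insert _ M"] M(1) by blast+
    then have "derives M (Neg \<phi>)" "derives M (Neg (Neg \<phi>))"
      by (auto dest: deduction)
    then have "derives M Bot"
      by (intro derives_conseq[of "[Neg \<phi>, Neg (Neg \<phi>)]"]) auto
    then show False using M by simp
  qed
  then show ?thesis using M by (auto simp: mcs_def)
qed

lemma mcs_refutes:
  assumes "\<phi> \<notin> L"
  shows "\<exists>x. mcs x \<and> \<phi> \<notin> x"
proof -
  have "\<not> derives {Neg \<phi>} Bot"
  proof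
    assume "derives {Neg \<phi>} Bot"
    then have "derives {} (Neg (Neg \<phi>))" by (rule deduction)
    then have "derives {} \<phi>" by (intro derives_conseq[of "[Neg (Neg \<phi>)]"]) auto
    then show False using assms by (simp add: derives_def)
  qed
  then obtain x where "mcs x" "Neg \<phi> \<in> x" using lindenbaum by auto
  then show ?thesis using mcs_Imp mcs_Bot by blast
qed

section \<open>Canonical relations\<close>

definition canon :: "modality \<Rightarrow> fm set rel" where
  "canon m = {(x, y). mcs x \<and> mcs y \<and> (\<forall>\<phi>\<in>y. Poss m \<phi> \<in> x)}"

lemma mcs_dual:
  assumes "mcs x"
  shows "Poss m \<phi> \<in> x \<longleftrightarrow> Nec m (Neg \<phi>) \<notin> x"
  using mcs_theorem[OF assms dual[of m \<phi>]] by (auto simp: mcs_Imp[OF assms] mcs_Bot[OF assms])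

text \<open>Necessitation boxes the whole iterated implication; axiom \<open>K\<close> then peels
  off one boxed premise at a time.\<close>

lemma mcs_Nec_derives:
  assumes "mcs x" "derives {\<phi>. Nec m \<phi> \<in> x} \<psi>"
  shows "Nec m \<psi> \<in> x"
proof -
  obtain xs where xs: "set xs \<subseteq> {\<phi>. Nec m \<phi> \<in> x}" "foldr Imp xs \<psi> \<in> L"
    using assms by (auto simp: derives_def)
  have "Nec m (foldr Imp xs \<psi>) \<in> x" using mcs_theorem nec xs assms by blast
  then show ?thesis using xs(1)
  proof (induction xs)
    case (Cons a xs)
    have "Imp (Nec m (Imp a (foldr Imp xs \<psi>))) (Imp (Nec m a) (Nec m (foldr Imp xs \<psi>))) \<in> x"
      using mcs_theorem K assms by blast
    then have "Nec m (foldr Imp xs \<psi>) \<in> x"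
      using Cons.prems by (simp add: mcs_Imp[OF assms(1), of _ "Imp _ _"] mcs_Imp[OF assms(1), of "Nec _ _" "Nec _ _"])
    then show ?case using Cons by auto
  qed auto
qed

text \<open>A maximal consistent set that contains the boxed part of \<open>x\<close> is a successor
  of \<open>x\<close>: by duality, \<open>Poss m \<phi> \<notin> x\<close> would put
  \<open>Neg \<phi>\<close> into it.\<close>

lemma canon_extend:
  assumes x: "mcs x" and cons: "\<not> derives ({\<phi>. Nec m \<phi> \<in> x} \<union> \<Delta>) Bot"
  shows "\<exists>y. (x, y) \<in> canon m \<and> \<Delta> \<subseteq> y"
proof -
  obtain y where y: "mcs y" "{\<phi>. Nec m \<phi> \<in> x} \<union> \<Delta> \<subseteq> y" using lindenbaum[OF cons] by blast
  have "Poss m \<phi> \<in> x" if "\<phi> \<in> y" for \<phi>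
  proof (rule ccontr)
    assume "Poss m \<phi> \<notin> x"
    then have "Nec m (Neg \<phi>) \<in> x" using mcs_dual[OF x, of m \<phi>] by blast
    then have "Neg \<phi> \<in> y" using y by blast
    then show False using that mcs_Imp[OF y(1)] mcs_Bot[OF y(1)] by blast
  qed
  then show ?thesis using x y by (auto simp: canon_def)
qed

lemma mcs_Poss:
  assumes "mcs x"
  shows "Poss m \<phi> \<in> x \<longleftrightarrow> (\<exists>y. (x, y) \<in> canon m \<and> \<phi> \<in> y)"
proof
  assume \<phi>: "Poss m \<phi> \<in> x"
  have "\<not> derives ({\<psi>. Nec m \<psi> \<in> x} \<union> {\<phi>}) Bot"
  proof
    assume "derives ({\<psi>. Nec m \<psi> \<in> x} \<union> {\<phi>}) Bot"
    then have "derives {\<psi>. Nec m \<psi> \<in> x} (Neg \<phi>)" by (intro deduction) simp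
    then have "Nec m (Neg \<phi>) \<in> x" by (rule mcs_Nec_derives[OF assms])
    then show False using \<phi> mcs_dual[OF assms, of m \<phi>] by blast
  qed
  then show "\<exists>y. (x, y) \<in> canon m \<and> \<phi> \<in> y" using canon_extend[OF assms, of m "{\<phi>}"] by auto
qed (auto simp: canon_def)

lemma mcs_Nec:
  assumes "mcs x"
  shows "Nec m \<phi> \<in> x \<longleftrightarrow> (\<forall>y. (x, y) \<in> canon m \<longrightarrow> \<phi> \<in> y)"
proof -
  have "Neg \<phi> \<in> y \<longleftrightarrow> \<phi> \<notin> y" if "(x, y) \<in> canon m" for y
    using that mcs_Imp mcs_Bot unfolding canon_def by blast
  then show ?thesis
    using mcs_Imp[OF assms, of "Poss m (Neg \<phi>)" Bot] mcs_Bot[OF assms] mcs_Poss[OF assms, of m "Neg \<phi>"]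
    by blast
qed

text \<open>An inconsistency of \<open>\<Delta>\<close> with the boxed part of \<open>x\<close>
  involves a finite part of \<open>\<Delta>\<close> only, and some successor already contains that
  part.\<close>

lemma canon_compact:
  assumes x: "mcs x" and "\<And>ds. set ds \<subseteq> \<Delta> \<Longrightarrow> \<exists>y. (x, y) \<in> canon m \<and> set ds \<subseteq> y"
  shows "\<exists>y. (x, y) \<in> canon m \<and> \<Delta> \<subseteq> y"
proof (rule canon_extend[OF x], rule notI)
  assume "derives ({\<phi>. Nec m \<phi> \<in> x} \<union> \<Delta>) Bot"
  then obtain ds where ds: "set ds \<subseteq> \<Delta>" "derives {\<phi>. Nec m \<phi> \<in> x} (foldr Imp ds Bot)"
    using derives_split by blast
  obtain y where y: "(x, y) \<in> canon m" "set ds \<subseteq> y" using assms(2) ds(1) by blast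
  have "foldr Imp ds Bot \<in> y" using mcs_Nec_derives[OF x ds(2)] mcs_Nec[OF x] y(1) by blast
  moreover have "mcs y" using y(1) by (simp add: canon_def)
  ultimately show False using mcs_foldr_Imp mcs_Bot y(2) by blast
qed

lemma canon_commute:
  assumes ax: "\<And>\<phi>. Imp (Poss m (Poss n \<phi>)) (Poss n (Poss m \<phi>)) \<in> L"
  shows "canon m O canon n \<subseteq> canon n O canon m"
proof clarify
  fix x y z assume xy: "(x, y) \<in> canon m" and yz: "(y, z) \<in> canon n"
  then have x: "mcs x" and z: "mcs z" by (auto simp: canon_def)
  have "\<exists>u. (x, u) \<in> canon n \<and> Poss m ` z \<subseteq> u"
  proof (rule canon_compact[OF x])
    fix ds assume "set ds \<subseteq> Poss m ` z"
    then have "ds \<in> lists (Poss m ` z)" by auto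
    then obtain cs where cs: "set cs \<subseteq> z" "ds = map (Poss m) cs" unfolding lists_image by auto
    \<comment> \<open>This is the conjunction of \<open>cs\<close>, written as a negated iterated
      implication.\<close>
    let ?c = "Neg (foldr Imp cs Bot)"
    have c: "?c \<in> w \<longleftrightarrow> set cs \<subseteq> w" if "mcs w" for w
      by (simp add: mcs_foldr_Imp[OF that] mcs_Imp[OF that] mcs_Bot[OF that])
    have "?c \<in> z" using c[OF z] cs(1) by blast
    then have "Poss m (Poss n ?c) \<in> x" using xy yz unfolding canon_def by blast
    then have "Poss n (Poss m ?c) \<in> x"
      using mcs_theorem[OF x ax[of ?c]] mcs_Imp[OF x, of "Poss m (Poss n ?c)"] by blast
    then obtain u where u: "(x, u) \<in> canon n" "Poss m ?c \<in> u"
      using mcs_Poss[OF x, of n] by blast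
    then obtain w where w: "(u, w) \<in> canon m" "?c \<in> w" using mcs_Poss[of u] unfolding canon_def by blast
    have "mcs w" using w(1) by (simp add: canon_def)
    then have "set cs \<subseteq> w" using c w(2) by blast
    moreover have "\<forall>\<phi>\<in>w. Poss m \<phi> \<in> u" using w(1) by (simp add: canon_def)
    ultimately have "set ds \<subseteq> u" unfolding cs(2) set_map by blast
    then show "\<exists>u. (x, u) \<in> canon n \<and> set ds \<subseteq> u" using u by blast
  qed
  then obtain u where u: "(x, u) \<in> canon n" "Poss m ` z \<subseteq> u" by blast
  then have "(u, z) \<in> canon m" using z unfolding canon_def by blast
  then show "(x, z) \<in> canon n O canon m" using u by blast
qed

lemma canon_refl:
  assumes "\<And>\<phi>. Imp (Nec m \<phi>) \<phi> \<in> L" and x: "mcs x"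
  shows "(x, x) \<in> canon m"
proof -
  have "Poss m \<phi> \<in> x" if "\<phi> \<in> x" for \<phi>
  proof -
    have "Imp (Nec m (Neg \<phi>)) (Neg \<phi>) \<in> x" using assms mcs_theorem by blast
    then show ?thesis using that mcs_dual[OF x, of m \<phi>] mcs_Imp[OF x] mcs_Bot[OF x] by blast
  qed
  then show ?thesis using x by (auto simp: canon_def)
qed

text \<open>The hypothesis speaks of maximal consistent sets and not of a theorem of
  \<open>L\<close>, because for \<open>Dia\<close> the step from \<open>Box \<phi>\<close> to
  \<open>Box (Box \<phi>)\<close> is derived from Grz inside the canonical model.\<close>

lemma canon_trans:
  assumes "\<And>\<phi> x. mcs x \<Longrightarrow> Nec m \<phi> \<in> x \<Longrightarrow> Nec m (Nec m \<phi>) \<in> x"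
  shows "trans (canon m)"
proof (rule transI)
  fix x y z assume xy: "(x, y) \<in> canon m" and yz: "(y, z) \<in> canon m"
  then have x: "mcs x" and y: "mcs y" and z: "mcs z" by (auto simp: canon_def)
  have "Poss m \<phi> \<in> x" if "\<phi> \<in> z" for \<phi>
  proof (rule ccontr)
    assume "Poss m \<phi> \<notin> x"
    then have "Nec m (Neg \<phi>) \<in> x" using mcs_dual[OF x, of m \<phi>] by blast
    then have "Nec m (Neg \<phi>) \<in> y" using assms[OF x] mcs_Nec[OF x] xy by blast
    then have "Neg \<phi> \<in> z" using mcs_Nec[OF y] yz by blast
    then show False using that mcs_Imp[OF z] mcs_Bot[OF z] by blast
  qed
  then show "(x, z) \<in> canon m" using x z by (auto simp: canon_def)
qed

end

section \<open>From a model to a finite partially ordered frame\<close>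

text \<open>Truth at a point is membership. Grz is assumed formula by formula, so its semantic
  consequences hold for definable properties, while \<open>R\<close> itself is just a
  preorder.\<close>

locale commuting_grz_model =
  fixes W :: "fm set set" and R E :: "fm set rel"
  assumes mem_Bot: "x \<in> W \<Longrightarrow> Bot \<notin> x"
    and mem_Imp: "x \<in> W \<Longrightarrow> Imp \<phi> \<psi> \<in> x \<longleftrightarrow> (\<phi> \<in> x \<longrightarrow> \<psi> \<in> x)"
    and mem_Dia: "x \<in> W \<Longrightarrow> Dia \<phi> \<in> x \<longleftrightarrow> (\<exists>y. (x, y) \<in> R \<and> \<phi> \<in> y)"
    and mem_Exists: "x \<in> W \<Longrightarrow> Exists \<phi> \<in> x \<longleftrightarrow> (\<exists>y. (x, y) \<in> E \<and> \<phi> \<in> y)"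
    and grz: "x \<in> W \<Longrightarrow> Imp (Box (Imp (Box (Imp \<phi> (Box \<phi>))) \<phi>)) \<phi> \<in> x"
    and R_subset: "R \<subseteq> W \<times> W" and R_refl: "x \<in> W \<Longrightarrow> (x, x) \<in> R" and R_trans: "trans R"
    and E_equiv: "equiv W E"
    and commute: "E O R = R O E"
begin

lemma R_W: "(x, y) \<in> R \<Longrightarrow> x \<in> W" "(x, y) \<in> R \<Longrightarrow> y \<in> W"
  using R_subset by auto

lemma E_W: "(x, y) \<in> E \<Longrightarrow> x \<in> W" "(x, y) \<in> E \<Longrightarrow> y \<in> W"
  using E_equiv by (auto simp: equiv_def refl_on_def)

lemma R_step: "(x, y) \<in> R \<Longrightarrow> (y, z) \<in> R \<Longrightarrow> (x, z) \<in> R"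
  using R_trans by (rule transD)

lemma E_refl: "x \<in> W \<Longrightarrow> (x, x) \<in> E"
  and E_sym: "(x, y) \<in> E \<Longrightarrow> (y, x) \<in> E"
  and E_step: "(x, y) \<in> E \<Longrightarrow> (y, z) \<in> E \<Longrightarrow> (x, z) \<in> E"
  using E_equiv by (auto simp: equiv_def refl_on_def dest: symD transD)

lemma E_R: "(x, y) \<in> E \<Longrightarrow> (y, z) \<in> R \<Longrightarrow> \<exists>u. (x, u) \<in> R \<and> (u, z) \<in> E"
  using commute relcompI[of x y E z R] by auto

lemma R_E: "(x, y) \<in> R \<Longrightarrow> (y, z) \<in> E \<Longrightarrow> \<exists>u. (x, u) \<in> E \<and> (u, z) \<in> R"
  using commute[symmetric] relcompI[of x y R z E] by auto

lemma mem_Neg: "x \<in> W \<Longrightarrow> Neg \<phi> \<in> x \<longleftrightarrow> \<phi> \<notin> x"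
  using mem_Imp mem_Bot by simp

lemma mem_Box: "x \<in> W \<Longrightarrow> Box \<phi> \<in> x \<longleftrightarrow> (\<forall>y. (x, y) \<in> R \<longrightarrow> \<phi> \<in> y)"
  using mem_Neg[of x "Dia (Neg \<phi>)"] mem_Dia[of x "Neg \<phi>"] mem_Neg[OF R_W(2)] by blast

section \<open>Definable properties and the semantic content of Grz\<close>

definition definable :: "(fm set \<Rightarrow> bool) \<Rightarrow> bool" where
  "definable P \<longleftrightarrow> (\<exists>\<phi>. \<forall>x\<in>W. \<phi> \<in> x \<longleftrightarrow> P x)"

lemma definable_formula: "definable (\<lambda>x. \<phi> \<in> x)"
  unfolding definable_def by blast

lemma definable_not: "definable P \<Longrightarrow> definable (\<lambda>x. \<not> P x)"
  unfolding definable_def using mem_Neg by blast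

lemma definable_imp: "definable P \<Longrightarrow> definable Q \<Longrightarrow> definable (\<lambda>x. P x \<longrightarrow> Q x)"
proof -
  assume "definable P" "definable Q"
  then obtain \<phi> \<psi> where "\<forall>x\<in>W. \<phi> \<in> x \<longleftrightarrow> P x" "\<forall>x\<in>W. \<psi> \<in> x \<longleftrightarrow> Q x"
    by (auto simp: definable_def)
  then have "\<forall>x\<in>W. Imp \<phi> \<psi> \<in> x \<longleftrightarrow> (P x \<longrightarrow> Q x)" using mem_Imp by simp
  then show ?thesis unfolding definable_def by blast
qed

lemma definable_const: "definable (\<lambda>x. c)"
  using definable_formula[of Bot] definable_not[OF definable_formula[of Bot]] mem_Bot
  unfolding definable_def by (cases c) auto

lemma definable_iff_const: "definable P \<Longrightarrow> definable (\<lambda>x. P x \<longleftrightarrow> c)"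
  by (cases c) (simp_all add: definable_not)

lemma definable_and: "definable P \<Longrightarrow> definable Q \<Longrightarrow> definable (\<lambda>x. P x \<and> Q x)"
  using definable_not[OF definable_imp[OF _ definable_not], of P Q] by simp

lemma definable_ball:
  assumes "finite A" "\<And>a. a \<in> A \<Longrightarrow> definable (P a)"
  shows "definable (\<lambda>x. \<forall>a\<in>A. P a x)"
  using assms by (induction A) (simp_all add: definable_const definable_and)

lemma definable_Exists:
  assumes "definable P"
  shows "definable (\<lambda>x. \<exists>y. (x, y) \<in> E \<and> P y)"
proof -
  obtain \<phi> where "\<forall>x\<in>W. \<phi> \<in> x \<longleftrightarrow> P x" using assms by (auto simp: definable_def)
  then have "\<forall>x\<in>W. Exists \<phi> \<in> x \<longleftrightarrow> (\<exists>y. (x, y) \<in> E \<and> P y)"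
    using mem_Exists E_W by metis
  then show ?thesis unfolding definable_def by blast
qed

text \<open>Grz is used for the negation of a formula that defines \<open>P\<close>. Its conclusion
  fails at \<open>x\<close>, so its boxed premise fails too, which yields \<open>y\<close> with
  \<open>P y\<close> above which a loss of \<open>P\<close> is final.\<close>

lemma definable_last:
  assumes "definable P" "x \<in> W" "P x"
  shows "\<exists>y. (x, y) \<in> R \<and> P y \<and> (\<forall>z w. (y, z) \<in> R \<longrightarrow> \<not> P z \<longrightarrow> (z, w) \<in> R \<longrightarrow> \<not> P w)"
proof -
  obtain \<phi> where \<phi>: "\<And>x. x \<in> W \<Longrightarrow> \<phi> \<in> x \<longleftrightarrow> P x" using assms by (auto simp: definable_def)
  let ?n = "Neg \<phi>"
  have n: "?n \<in> y \<longleftrightarrow> \<not> P y" if "y \<in> W" for y using mem_Neg \<phi> that by simp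
  have "Box (Imp (Box (Imp ?n (Box ?n))) ?n) \<notin> x"
    using grz[OF assms(2), of ?n] mem_Imp[OF assms(2), of _ ?n] n[OF assms(2)] assms(3) by blast
  then obtain y where y: "(x, y) \<in> R" "Imp (Box (Imp ?n (Box ?n))) ?n \<notin> y"
    using mem_Box[OF assms(2)] by blast
  note yW = R_W(2)[OF y(1)]
  have "Box (Imp ?n (Box ?n)) \<in> y" "P y" using y(2) mem_Imp[OF yW, of _ ?n] n[OF yW] by blast+
  moreover have "\<not> P w" if "(y, z) \<in> R" "\<not> P z" "(z, w) \<in> R" for z w
  proof -
    note zW = R_W(2)[OF that(1)] and wW = R_W(2)[OF that(3)]
    have "Imp ?n (Box ?n) \<in> z" using mem_Box[OF yW] calculation(1) that(1) by blast
    then have "Box ?n \<in> z" using mem_Imp[OF zW, of ?n] n[OF zW] that(2) by blast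
    then show ?thesis using mem_Box[OF zW] that(3) n[OF wW] by blast
  qed
  ultimately show ?thesis using y(1) by blast
qed

end

text \<open>The components are a class type, a type and a set of reachable types: the first fixes
  the class, the second decides truth, the third orders points inside a class.\<close>

type_synonym point = "fm set set \<times> fm set \<times> fm set set"

locale filtration = commuting_grz_model +
  fixes \<Sigma> :: "fm set"
  assumes fin: "finite \<Sigma>"
    and sub_Imp: "Imp \<phi> \<psi> \<in> \<Sigma> \<Longrightarrow> \<phi> \<in> \<Sigma> \<and> \<psi> \<in> \<Sigma>"
    and sub_Poss: "Poss m \<phi> \<in> \<Sigma> \<Longrightarrow> \<phi> \<in> \<Sigma>"
begin

section \<open>Types and class types\<close>

definition tp :: "fm set \<Rightarrow> fm set" where
  "tp x = x \<inter> \<Sigma>"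

definition class_tp :: "fm set \<Rightarrow> fm set set" where
  "class_tp x = {tp y |y. (x, y) \<in> E}"

definition above :: "fm set \<Rightarrow> fm set set set" where
  "above x = {class_tp y |y. (x, y) \<in> R}"

definition reach :: "fm set \<Rightarrow> fm set set" where
  "reach x = {tp y |y. (x, y) \<in> R \<and> class_tp y = class_tp x}"

lemma class_tp_E:
  assumes "(x, y) \<in> E"
  shows "class_tp x = class_tp y"
proof -
  have "(x, z) \<in> E \<longleftrightarrow> (y, z) \<in> E" for z
    using E_step[OF assms, of z] E_step[OF E_sym[OF assms], of z] by blast
  then show ?thesis by (simp add: class_tp_def)
qed

lemma tp_in_class_tp: "x \<in> W \<Longrightarrow> tp x \<in> class_tp x"
  using E_refl by (auto simp: class_tp_def)

lemma class_tp_subset: "class_tp x \<subseteq> Pow \<Sigma>"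
  by (auto simp: class_tp_def tp_def)

lemma finite_above: "finite (above x)"
proof (rule finite_subset)
  show "above x \<subseteq> Pow (Pow \<Sigma>)" unfolding above_def using class_tp_subset by blast
qed (simp add: fin)

lemma above_mono:
  assumes "(x, y) \<in> R"
  shows "above y \<subseteq> above x"
  unfolding above_def using R_step[OF assms] by blast

text \<open>A class type is fixed by finitely many conditions, one for each
  \<open>s \<subseteq> \<Sigma>\<close>: whether some \<open>E\<close>-related point has type
  \<open>s\<close>. Each is expressed by \<open>Exists\<close> in front of a finite
  conjunction.\<close>

lemma definable_class_tp: "definable (\<lambda>x. class_tp x = \<beta>)"
proof (cases "\<beta> \<subseteq> Pow \<Sigma>")
  case True
  have "definable (\<lambda>x. \<forall>s\<in>Pow \<Sigma>. (\<exists>y. (x, y) \<in> E \<and> (\<forall>\<phi>\<in>\<Sigma>. \<phi> \<in> y \<longleftrightarrow> \<phi> \<in> s)) \<longleftrightarrow> s \<in> \<beta>)"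
    by (intro definable_ball definable_iff_const definable_Exists definable_formula)
      (use fin in auto)
  moreover have "(\<forall>\<phi>\<in>\<Sigma>. \<phi> \<in> y \<longleftrightarrow> \<phi> \<in> s) \<longleftrightarrow> s = tp y" if "s \<in> Pow \<Sigma>" for s y
    using that by (auto simp: tp_def)
  then have "(\<forall>s\<in>Pow \<Sigma>. (\<exists>y. (x, y) \<in> E \<and> (\<forall>\<phi>\<in>\<Sigma>. \<phi> \<in> y \<longleftrightarrow> \<phi> \<in> s)) \<longleftrightarrow> s \<in> \<beta>) \<longleftrightarrow>
      (\<forall>s\<in>Pow \<Sigma>. s \<in> class_tp x \<longleftrightarrow> s \<in> \<beta>)" for x
    by (simp add: class_tp_def conj_commute)
  moreover have "(\<forall>s\<in>Pow \<Sigma>. s \<in> class_tp x \<longleftrightarrow> s \<in> \<beta>) \<longleftrightarrow> class_tp x = \<beta>" for x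
    using True class_tp_subset[of x] by blast
  ultimately show ?thesis by simp
next
  case False
  then have "(class_tp x = \<beta>) = False" for x using class_tp_subset[of x] by blast
  then show ?thesis using definable_const[of False] by simp
qed

text \<open>A class type need not determine which class types are seen, so the least count among its
  points is taken.\<close>

definition rank :: "fm set set \<Rightarrow> nat" where
  "rank \<beta> = (LEAST n. \<exists>x\<in>W. class_tp x = \<beta> \<and> card (above x) = n)"

lemma rank_le: "x \<in> W \<Longrightarrow> rank (class_tp x) \<le> card (above x)"
  unfolding rank_def by (rule Least_le) blast

text \<open>A class of least rank among those of its type can be chosen so that its type is never
  left and met again; every other class type above it then has smaller rank.\<close>
lemma centre_exists:
  assumes "x \<in> W"
  shows "\<exists>c\<in>W. class_tp c = class_tp x \<and>
    (\<forall>y. (c, y) \<in> R \<longrightarrow> class_tp y \<noteq> class_tp x \<longrightarrow> rank (class_tp y) < rank (class_tp x))"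
proof -
  let ?\<beta> = "class_tp x"
  have "\<exists>n. \<exists>x\<in>W. class_tp x = ?\<beta> \<and> card (above x) = n" using assms by blast
  then have "\<exists>d\<in>W. class_tp d = ?\<beta> \<and> card (above d) = rank ?\<beta>"
    unfolding rank_def by (rule LeastI_ex)
  then obtain d where d: "d \<in> W" "class_tp d = ?\<beta>" "card (above d) = rank ?\<beta>" by blast
  obtain c where c: "(d, c) \<in> R" "class_tp c = ?\<beta>"
    and last: "\<And>z w. (c, z) \<in> R \<Longrightarrow> class_tp z \<noteq> ?\<beta> \<Longrightarrow> (z, w) \<in> R \<Longrightarrow> class_tp w \<noteq> ?\<beta>"
    using definable_last[OF definable_class_tp d(1,2)] by blast
  \<comment> \<open>Passing from \<open>d\<close> up to \<open>c\<close> can only shrink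
    \<open>above\<close>, so the minimal count is kept.\<close>
  have card_c: "card (above c) \<le> rank ?\<beta>"
    using card_mono[OF finite_above above_mono[OF c(1)]] d(3) by simp
  have "rank (class_tp y) < rank ?\<beta>" if "(c, y) \<in> R" "class_tp y \<noteq> ?\<beta>" for y
  proof -
    have "?\<beta> \<notin> above y" using last[OF that] by (auto simp: above_def)
    moreover have "?\<beta> \<in> above c" using R_refl[OF R_W(2)[OF c(1)]] c(2) by (auto simp: above_def)
    ultimately have "above y \<subset> above c" using above_mono[OF that(1)] by blast
    then have "card (above y) < card (above c)" using finite_above by (rule psubset_card_mono[rotated])
    then show ?thesis using rank_le[OF R_W(2)[OF that(1)]] card_c by linarith
  qed
  then show ?thesis using c R_W(2)[OF c(1)] by blast
qed

section \<open>Centres and regions\<close>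

definition centre :: "fm set set \<Rightarrow> fm set" where
  "centre \<beta> = (SOME c. c \<in> W \<and> class_tp c = \<beta> \<and>
    (\<forall>y. (c, y) \<in> R \<longrightarrow> class_tp y \<noteq> \<beta> \<longrightarrow> rank (class_tp y) < rank \<beta>))"

lemma centre:
  assumes "x \<in> W"
  shows "centre (class_tp x) \<in> W" "class_tp (centre (class_tp x)) = class_tp x"
    "(centre (class_tp x), y) \<in> R \<Longrightarrow> class_tp y \<noteq> class_tp x \<Longrightarrow> rank (class_tp y) < rank (class_tp x)"
  using someI_ex[OF centre_exists[OF assms, unfolded Bex_def]] unfolding centre_def by blast+

text \<open>Composing with \<open>E\<close> makes the region a union of whole
  \<open>E\<close>-classes.\<close>

definition region :: "fm set set" where
  "region = {x \<in> W. (centre (class_tp x), x) \<in> R O E}"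

lemma region_W: "x \<in> region \<Longrightarrow> x \<in> W"
  by (simp add: region_def)

lemma centre_region:
  assumes "x \<in> W" "(centre (class_tp x), y) \<in> E"
  shows "y \<in> region"
proof -
  have "class_tp y = class_tp x" using class_tp_E[OF assms(2)] centre(2)[OF assms(1)] by simp
  then show ?thesis using assms R_refl centre(1) E_W by (auto simp: region_def)
qed

text \<open>By commutation the step to \<open>y\<close> is matched by a step from a point above the
  centre to some \<open>u\<close> with \<open>(u, y) \<in> E\<close>. As \<open>u\<close> and
  \<open>y\<close> have the same class type, the choice of the centre applies.\<close>

lemma region_R:
  assumes "x \<in> region" "(x, y) \<in> R"
  shows "class_tp y = class_tp x \<Longrightarrow> y \<in> region"
    and "class_tp y \<noteq> class_tp x \<Longrightarrow> rank (class_tp y) < rank (class_tp x)"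
proof -
  obtain x' where x': "(centre (class_tp x), x') \<in> R" "(x', x) \<in> E"
    using assms(1) by (auto simp: region_def)
  obtain u where u: "(x', u) \<in> R" "(u, y) \<in> E" using E_R[OF x'(2) assms(2)] by blast
  have cu: "(centre (class_tp x), u) \<in> R" using R_step[OF x'(1) u(1)] .
  show "y \<in> region" if "class_tp y = class_tp x"
    using that cu u(2) R_W(2)[OF assms(2)] by (auto simp: region_def)
  show "rank (class_tp y) < rank (class_tp x)" if "class_tp y \<noteq> class_tp x"
    using that centre(3)[OF region_W[OF assms(1)] cu] class_tp_E[OF u(2)] by simp
qed

text \<open>This is the condition of the transitive filtration. Comparing diamonds is enough, since
  by reflexivity of \<open>R\<close> the type of a point where \<open>\<phi>\<close> holds contains
  \<open>Dia \<phi>\<close> whenever \<open>Dia \<phi> \<in> \<Sigma>\<close>.\<close>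

definition cons :: "fm set \<Rightarrow> fm set \<Rightarrow> bool" where
  "cons s t \<longleftrightarrow> (\<forall>\<phi>. Dia \<phi> \<in> t \<longrightarrow> Dia \<phi> \<in> s)"

text \<open>The Egli-Milner lifting of \<open>cons\<close> to sets of types; its halves serve the
  two inclusions of \<open>F_commute\<close>.\<close>

definition class_cons :: "fm set set \<Rightarrow> fm set set \<Rightarrow> bool" where
  "class_cons \<beta> \<gamma> \<longleftrightarrow> (\<forall>s\<in>\<beta>. \<exists>t\<in>\<gamma>. cons s t) \<and> (\<forall>t\<in>\<gamma>. \<exists>s\<in>\<beta>. cons s t)"

lemma cons_R: "(x, y) \<in> R \<Longrightarrow> cons (tp x) (tp y)"
  unfolding cons_def tp_def using mem_Dia R_W R_step by blast

lemma cons_trans: "cons s t \<Longrightarrow> cons t u \<Longrightarrow> cons s u"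
  by (simp add: cons_def)

lemma class_cons_trans: "class_cons \<beta> \<gamma> \<Longrightarrow> class_cons \<gamma> \<delta> \<Longrightarrow> class_cons \<beta> \<delta>"
  unfolding class_cons_def by (metis cons_trans)

text \<open>The two halves come from \<open>E_R\<close> and \<open>R_E\<close>, which move the step
  from \<open>x\<close> to \<open>y\<close> to the other points of the two classes.\<close>

lemma class_cons_R:
  assumes "(x, y) \<in> R"
  shows "class_cons (class_tp x) (class_tp y)"
  unfolding class_cons_def
proof (intro conjI ballI)
  fix s assume "s \<in> class_tp x"
  then obtain x' where x': "(x, x') \<in> E" "s = tp x'" by (auto simp: class_tp_def)
  obtain u where "(x', u) \<in> R" "(u, y) \<in> E" using E_R[OF E_sym[OF x'(1)] assms] by blast
  then show "\<exists>t\<in>class_tp y. cons s t"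
    using cons_R x'(2) by (intro bexI[of _ "tp u"]) (auto simp: class_tp_def dest: E_sym)
next
  fix t assume "t \<in> class_tp y"
  then obtain y' where y': "(y, y') \<in> E" "t = tp y'" by (auto simp: class_tp_def)
  obtain u where "(x, u) \<in> E" "(u, y') \<in> R" using R_E[OF assms y'(1)] by blast
  then show "\<exists>s\<in>class_tp x. cons s t"
    using cons_R y'(2) by (intro bexI[of _ "tp u"]) (auto simp: class_tp_def)
qed

section \<open>The finite frame and its order\<close>

definition pt :: "fm set \<Rightarrow> point" where
  "pt x = (class_tp x, tp x, reach x)"

definition points :: "point set" where
  "points = pt ` region"

text \<open>Inside a class, the types reachable within the region of that class type must shrink
  strictly, which makes the relation antisymmetric; between classes, the rank drops.\<close>
inductive below :: "point \<Rightarrow> point \<Rightarrow> bool" where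
  refl: "below p p"
| inner: "v' \<subset> v \<Longrightarrow> t' \<in> v \<Longrightarrow> below (\<beta>, t, v) (\<beta>, t', v')"
| outer: "rank \<beta>' < rank \<beta> \<Longrightarrow> class_cons \<beta> \<beta>' \<Longrightarrow> cons t t' \<Longrightarrow> below (\<beta>, t, v) (\<beta>', t', v')"

definition FR :: "point rel" where
  "FR = {(p, q). p \<in> points \<and> q \<in> points \<and> below p q}"

definition FE :: "point rel" where
  "FE = {(p, q). p \<in> points \<and> q \<in> points \<and> fst p = fst q}"

lemma reach_cons: "t \<in> reach x \<Longrightarrow> cons (tp x) t"
  using cons_R by (auto simp: reach_def)

lemma point_cases:
  assumes "p \<in> points"
  obtains x where "x \<in> region" "p = (class_tp x, tp x, reach x)"
  using assms by (auto simp: points_def pt_def)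

text \<open>The \<open>E\<close>-class of the centre lies in the region and realises every type in
  its class type.\<close>

lemma point_exists:
  assumes "p \<in> points" "t \<in> fst p"
  shows "\<exists>v. (fst p, t, v) \<in> points"
proof -
  obtain x where x: "x \<in> region" "p = (class_tp x, tp x, reach x)" using assms(1) by (rule point_cases)
  then have "t \<in> class_tp (centre (class_tp x))"
    using assms(2) centre(2) region_W by simp
  then obtain y where y: "(centre (class_tp x), y) \<in> E" "t = tp y" by (auto simp: class_tp_def)
  have "y \<in> region" using centre_region y(1) x(1) region_W by blast
  moreover have "class_tp y = class_tp x"
    using class_tp_E[OF y(1)] centre(2) x(1) region_W by simp
  ultimately have "(class_tp x, t, reach y) \<in> points" using y(2) by (auto simp: points_def pt_def)
  then show ?thesis using x(2) by auto
qed

lemma point_tp: "p \<in> points \<Longrightarrow> fst (snd p) \<in> fst p"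
  using tp_in_class_tp region_W by (auto elim!: point_cases)

lemma finite_points: "finite points"
proof (rule finite_subset)
  show "points \<subseteq> Pow (Pow \<Sigma>) \<times> Pow \<Sigma> \<times> Pow (Pow \<Sigma>)"
    using class_tp_subset by (auto simp: points_def pt_def tp_def reach_def)
  show "finite (Pow (Pow \<Sigma>) \<times> Pow \<Sigma> \<times> Pow (Pow \<Sigma>))" using fin by simp
qed

text \<open>Two inner steps compose because \<open>v\<close> shrinks and the last type lies in the
  smaller set. An outer step absorbs inner ones on either side: they keep the class type, and
  \<open>reach_cons\<close> turns reachability of a type into \<open>cons\<close>.\<close>

lemma FR_trans: "trans FR"
proof (rule transI)
  fix p q r assume pq: "(p, q) \<in> FR" and qr: "(q, r) \<in> FR"
  then have p: "p \<in> points" and q: "q \<in> points" and r: "r \<in> points"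
    and bpq: "below p q" and bqr: "below q r" by (auto simp: FR_def)
  have inner_cons: "cons (fst (snd p')) t'" if "p' \<in> points" "t' \<in> snd (snd p')" for p' t'
    using that reach_cons by (auto elim!: point_cases)
  from bpq have "below p r"
  proof cases
    case refl
    then show ?thesis using bqr by simp
  next
    case (inner v' v t' \<beta> t)
    from bqr show ?thesis
    proof cases
      case refl
      then show ?thesis using bpq by simp
    next
      case (inner w' w s' \<gamma> s)
      then show ?thesis using \<open>v' \<subset> v\<close> \<open>p = (\<beta>, t, v)\<close> \<open>q = (\<beta>, t', v')\<close>
        by (auto intro!: below.inner)
    next
      case (outer \<gamma>' \<gamma> s s' w w')
      have "cons t t'" using inner_cons[OF p] inner by auto
      then show ?thesis using outer inner by (auto intro!: below.outer intro: cons_trans)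
    qed
  next
    case (outer \<beta>' \<beta> t t' v v')
    from bqr show ?thesis
    proof cases
      case refl
      then show ?thesis using bpq by simp
    next
      case (inner w' w s' \<gamma> s)
      have "cons t' s'" using inner_cons[OF q] inner outer by auto
      then show ?thesis using outer inner by (auto intro!: below.outer intro: cons_trans)
    next
      case (outer \<gamma>' \<gamma> s s' w w')
      then show ?thesis using \<open>rank \<beta>' < rank \<beta>\<close> \<open>class_cons \<beta> \<beta>'\<close> \<open>cons t t'\<close>
          \<open>p = (\<beta>, t, v)\<close> \<open>q = (\<beta>', t', v')\<close>
        by (auto intro!: below.outer intro: cons_trans class_cons_trans)
    qed
  qed
  then show "(p, r) \<in> FR" using p r by (simp add: FR_def)
qed

text \<open>Outer steps lower the rank and inner ones preserve it, so a cycle would consist of inner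
  steps, whose strict inclusions cannot be reversed.\<close>

lemma FR_antisym: "antisym FR"
  by (rule antisymI) (auto simp: FR_def elim!: below.cases)

lemma FR_refl: "refl_on points FR"
  by (auto simp: refl_on_def FR_def intro: below.refl)

lemma FE_equiv: "equiv points FE"
  by (auto simp: equiv_def refl_on_def FE_def sym_def trans_def)

text \<open>A step inside a class is absorbed by \<open>FE\<close>, with a reflexive
  \<open>FR\<close> step. For an outer step \<open>class_cons\<close> supplies a matching type and
  \<open>point_exists\<close> a point of that type; its third component is irrelevant to
  \<open>below.outer\<close>.\<close>

lemma F_commute: "FE O FR = FR O FE"
proof
  show "FE O FR \<subseteq> FR O FE"
  proof clarify
    fix \<alpha> a u \<beta> b v \<gamma> c w
    assume "((\<alpha>, a, u), (\<beta>, b, v)) \<in> FE" and "((\<beta>, b, v), (\<gamma>, c, w)) \<in> FR"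
    then have p: "(\<alpha>, a, u) \<in> points" and r: "(\<gamma>, c, w) \<in> points" and "\<beta> = \<alpha>"
      and bel: "below (\<beta>, b, v) (\<gamma>, c, w)" by (auto simp: FE_def FR_def)
    from bel consider "\<gamma> = \<beta>" | "rank \<gamma> < rank \<beta>" "class_cons \<beta> \<gamma>"
      by cases auto
    then show "((\<alpha>, a, u), (\<gamma>, c, w)) \<in> FR O FE"
    proof cases
      case 1
      then show ?thesis using p r \<open>\<beta> = \<alpha>\<close>
        by (intro relcompI[of _ "(\<alpha>, a, u)"]) (auto simp: FR_def FE_def intro: below.refl)
    next
      case 2
      have "a \<in> \<alpha>" using point_tp[OF p] by simp
      then obtain t where t: "t \<in> \<gamma>" "cons a t" using 2 \<open>\<beta> = \<alpha>\<close> by (auto simp: class_cons_def)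
      then obtain w' where "(\<gamma>, t, w') \<in> points" using point_exists[OF r] by auto
      then show ?thesis using p r t 2 \<open>\<beta> = \<alpha>\<close>
        by (intro relcompI[of _ "(\<gamma>, t, w')"]) (auto simp: FR_def FE_def intro: below.outer)
    qed
  qed
  show "FR O FE \<subseteq> FE O FR"
  proof clarify
    fix \<alpha> a u \<beta> b v \<gamma> c w
    assume "((\<alpha>, a, u), (\<beta>, b, v)) \<in> FR" and "((\<beta>, b, v), (\<gamma>, c, w)) \<in> FE"
    then have p: "(\<alpha>, a, u) \<in> points" and r: "(\<gamma>, c, w) \<in> points" and "\<beta> = \<gamma>"
      and bel: "below (\<alpha>, a, u) (\<beta>, b, v)" by (auto simp: FE_def FR_def)
    from bel consider "\<beta> = \<alpha>" | "rank \<beta> < rank \<alpha>" "class_cons \<alpha> \<beta>"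
      by cases auto
    then show "((\<alpha>, a, u), (\<gamma>, c, w)) \<in> FE O FR"
    proof cases
      case 1
      then show ?thesis using p r \<open>\<beta> = \<gamma>\<close>
        by (intro relcompI[of _ "(\<gamma>, c, w)"]) (auto simp: FR_def FE_def intro: below.refl)
    next
      case 2
      have "c \<in> \<gamma>" using point_tp[OF r] by simp
      then obtain t where t: "t \<in> \<alpha>" "cons t c" using 2 \<open>\<beta> = \<gamma>\<close> by (auto simp: class_cons_def)
      then obtain u' where "(\<alpha>, t, u') \<in> points" using point_exists[OF p] by auto
      then show ?thesis using p r t 2 \<open>\<beta> = \<gamma>\<close>
        by (intro relcompI[of _ "(\<alpha>, t, u')"]) (auto simp: FR_def FE_def intro: below.outer)
    qed
  qed
qed

section \<open>The truth lemma\<close>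

definition FV :: "nat \<Rightarrow> point set" where
  "FV n = {p \<in> points. Var n \<in> fst (snd p)}"

text \<open>The Grz axiom for \<open>\<psi>\<close> provides a witness after which \<open>\<psi>\<close> is never lost and met again.  If
  the witness reached the same types as \<open>x\<close>, it would see the type of \<open>x\<close>, which refutes \<open>\<psi>\<close>
  but sees it again.\<close>
lemma Dia_witness:
  assumes x: "x \<in> region" and \<psi>: "\<psi> \<in> \<Sigma>" "Dia \<psi> \<in> \<Sigma>" "Dia \<psi> \<in> x" "\<psi> \<notin> x"
  shows "\<exists>q. (pt x, q) \<in> FR \<and> \<psi> \<in> fst (snd q)"
proof -
  note xW = region_W[OF x]
  obtain y0 where y0: "(x, y0) \<in> R" "\<psi> \<in> y0" using \<psi>(3) mem_Dia[OF xW] by blast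
  obtain y where y: "(y0, y) \<in> R" "\<psi> \<in> y"
    and last: "\<And>z w. (y, z) \<in> R \<Longrightarrow> \<psi> \<notin> z \<Longrightarrow> (z, w) \<in> R \<Longrightarrow> \<psi> \<notin> w"
    using definable_last[OF definable_formula R_W(2)[OF y0(1)] y0(2)] by blast
  have xy: "(x, y) \<in> R" using R_step[OF y0(1) y(1)] .
  show ?thesis
  proof (cases "class_tp y = class_tp x")
    case True
    have yr: "y \<in> region" using region_R(1)[OF x xy True] .
    have "tp x \<notin> reach y"
    proof
      assume "tp x \<in> reach y"
      then obtain z where z: "(y, z) \<in> R" "tp z = tp x" by (auto simp: reach_def)
      then have "\<psi> \<notin> z" "Dia \<psi> \<in> z" using \<psi> by (auto simp: tp_def)
      then show False using last[OF z(1)] mem_Dia R_W(2)[OF z(1)] by blast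
    qed
    moreover have "tp x \<in> reach x" using R_refl[OF xW] by (auto simp: reach_def)
    moreover have "reach y \<subseteq> reach x" using R_step[OF xy] True by (auto simp: reach_def)
    ultimately have "reach y \<subset> reach x" by blast
    moreover have "tp y \<in> reach x" using xy True by (auto simp: reach_def)
    ultimately have "below (pt x) (pt y)" using True by (auto simp: pt_def intro: below.inner)
    then show ?thesis using x yr y(2) \<psi>(1)
      by (intro exI[of _ "pt y"]) (auto simp: FR_def points_def pt_def tp_def)
  next
    case False
    \<comment> \<open>Here \<open>y\<close> may lie outside the region, so it is replaced by a point
      of the same type in the class of the centre; outer steps depend only on types and class
      types.\<close>
    let ?c = "class_tp y"
    have yW: "y \<in> W" using R_W(2)[OF xy] .
    have "tp y \<in> class_tp (centre ?c)" using tp_in_class_tp[OF yW] centre(2)[OF yW] by simp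
    then obtain y' where y': "(centre ?c, y') \<in> E" "tp y' = tp y" by (auto simp: class_tp_def)
    have y'r: "y' \<in> region" using centre_region[OF yW y'(1)] .
    have "class_tp y' = ?c" using class_tp_E[OF y'(1)] centre(2)[OF yW] by simp
    then have "below (pt x) (pt y')"
      using region_R(2)[OF x xy False] class_cons_R[OF xy] cons_R[OF xy] y'(2)
      by (auto simp: pt_def intro: below.outer)
    then show ?thesis using x y'r y(2) y'(2) \<psi>(1)
      by (intro exI[of _ "pt y'"]) (auto simp: FR_def points_def pt_def tp_def)
  qed
qed

text \<open>Reflexivity of \<open>R\<close> puts \<open>Dia \<psi>\<close> into the type of
  \<open>q\<close>, and every kind of step carries diamonds back to the predecessor, inner ones by
  \<open>reach_cons\<close>.\<close>

lemma FR_sound: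
  assumes "(p, q) \<in> FR" "Dia \<psi> \<in> \<Sigma>" "\<psi> \<in> fst (snd q)"
  shows "Dia \<psi> \<in> fst (snd p)"
proof -
  have "q \<in> points" "p \<in> points" "below p q" using assms by (auto simp: FR_def)
  obtain y where y: "y \<in> region" "q = (class_tp y, tp y, reach y)"
    using \<open>q \<in> points\<close> by (rule point_cases)
  then have "Dia \<psi> \<in> fst (snd q)"
    using assms mem_Dia[OF region_W[OF y(1)]] R_refl[OF region_W[OF y(1)]] by (auto simp: tp_def)
  moreover have "cons (fst (snd p)) (fst (snd q))"
    using \<open>below p q\<close> \<open>p \<in> points\<close>
  proof cases
    case (inner v' v t' \<beta> t)
    obtain x where "p = (class_tp x, tp x, reach x)" using \<open>p \<in> points\<close> by (rule point_cases)
    then show ?thesis using inner reach_cons[of t' x] by simp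
  qed (auto simp: cons_def)
  ultimately show ?thesis by (simp add: cons_def)
qed

text \<open>For \<open>Exists\<close>, \<open>point_tp\<close> and \<open>point_exists\<close> show
  that the types found in a class of the frame are exactly the members of its class type.\<close>

lemma sat_filtration:
  "p \<in> points \<Longrightarrow> \<psi> \<in> \<Sigma> \<Longrightarrow> sat FR FE FV p \<psi> \<longleftrightarrow> \<psi> \<in> fst (snd p)"
proof (induction \<psi> arbitrary: p)
  case (Var n)
  then show ?case by (simp add: FV_def)
next
  case Bot
  obtain x where "x \<in> region" "p = (class_tp x, tp x, reach x)" using Bot.prems(1) by (rule point_cases)
  then show ?case using mem_Bot[OF region_W] by (simp add: tp_def)
next
  case (Imp \<phi> \<psi>)
  obtain x where x: "x \<in> region" "p = (class_tp x, tp x, reach x)" using Imp.prems(1) by (rule point_cases)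
  have "\<phi> \<in> \<Sigma>" "\<psi> \<in> \<Sigma>" using sub_Imp[OF Imp.prems(2)] by auto
  then show ?case
    using Imp.IH(1)[OF Imp.prems(1)] Imp.IH(2)[OF Imp.prems(1)] Imp.prems(2) x(2)
    by (simp add: tp_def mem_Imp[OF region_W[OF x(1)]])
next
  case (Poss m \<psi>)
  have sub: "\<psi> \<in> \<Sigma>" using sub_Poss[OF Poss.prems(2)] .
  obtain x where x: "x \<in> region" "p = (class_tp x, tp x, reach x)" using Poss.prems(1) by (rule point_cases)
  note xW = region_W[OF x(1)]
  show ?case
  proof (cases m)
    case MDia
    have "q \<in> points" if "(p, q) \<in> FR" for q using that by (simp add: FR_def)
    then have "sat FR FE FV p (Dia \<psi>) \<longleftrightarrow> (\<exists>q. (p, q) \<in> FR \<and> \<psi> \<in> fst (snd q))"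
      using Poss.IH[OF _ sub] by (simp only: sat.simps acc.simps) blast
    also have "\<dots> \<longleftrightarrow> Dia \<psi> \<in> fst (snd p)"
    proof
      assume "Dia \<psi> \<in> fst (snd p)"
      then have "Dia \<psi> \<in> x" using x by (simp add: tp_def)
      then show "\<exists>q. (p, q) \<in> FR \<and> \<psi> \<in> fst (snd q)"
      proof (cases "\<psi> \<in> x")
        case True
        then have "(p, p) \<in> FR \<and> \<psi> \<in> fst (snd p)"
          using x(2) sub refl_onD[OF FR_refl Poss.prems(1)] by (simp add: tp_def)
        then show ?thesis by blast
      next
        case False
        then show ?thesis
          using Dia_witness[OF x(1) sub _ \<open>Dia \<psi> \<in> x\<close>] Poss.prems x(2) MDia by (simp add: pt_def)
      qed
    next
      assume "\<exists>q. (p, q) \<in> FR \<and> \<psi> \<in> fst (snd q)"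
      then show "Dia \<psi> \<in> fst (snd p)" using FR_sound Poss.prems(2) MDia by blast
    qed
    finally show ?thesis using MDia by simp
  next
    case MEx
    have "q \<in> points" if "(p, q) \<in> FE" for q using that by (simp add: FE_def)
    then have "sat FR FE FV p (Exists \<psi>) \<longleftrightarrow> (\<exists>q. (p, q) \<in> FE \<and> \<psi> \<in> fst (snd q))"
      using Poss.IH[OF _ sub] by (simp only: sat.simps acc.simps) blast
    also have "\<dots> \<longleftrightarrow> (\<exists>t\<in>class_tp x. \<psi> \<in> t)"
    proof
      assume "\<exists>q. (p, q) \<in> FE \<and> \<psi> \<in> fst (snd q)"
      then obtain q where q: "(p, q) \<in> FE" "\<psi> \<in> fst (snd q)" by blast
      then have "q \<in> points" "fst q = class_tp x" using x(2) by (auto simp: FE_def)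
      then show "\<exists>t\<in>class_tp x. \<psi> \<in> t" using q point_tp[of q] by auto
    next
      assume "\<exists>t\<in>class_tp x. \<psi> \<in> t"
      then obtain t where t: "t \<in> class_tp x" "\<psi> \<in> t" by blast
      then obtain v where "(class_tp x, t, v) \<in> points" using point_exists[OF Poss.prems(1)] x(2) by auto
      then show "\<exists>q. (p, q) \<in> FE \<and> \<psi> \<in> fst (snd q)"
        using t x(2) Poss.prems(1) by (intro exI[of _ "(class_tp x, t, v)"]) (auto simp: FE_def)
    qed
    also have "\<dots> \<longleftrightarrow> Exists \<psi> \<in> x"
      unfolding mem_Exists[OF xW] class_tp_def tp_def using sub by blast
    finally show ?thesis using MEx x Poss.prems by (simp add: tp_def)
  qed
qed

lemma finite_refutation:
  assumes "x \<in> W" "\<phi> \<in> \<Sigma>" "\<phi> \<notin> x"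
  shows "\<exists>(X :: nat set) R' E'. finite X \<and> logic_frame MGrzB X R' E' \<and> refuted X R' E' \<phi>"
proof -
  \<comment> \<open>Since \<open>x\<close> may lie outside the region, the refutation is moved to a
    point of the same type in the class of the centre.\<close>
  have "tp x \<in> class_tp (centre (class_tp x))"
    using tp_in_class_tp centre(2) assms(1) by simp
  then obtain y where y: "(centre (class_tp x), y) \<in> E" "tp y = tp x" by (auto simp: class_tp_def)
  then have p: "pt y \<in> points" using centre_region[OF assms(1)] by (simp add: points_def)
  have "\<phi> \<notin> fst (snd (pt y))" using y(2) assms by (simp add: pt_def tp_def)
  then have "\<not> sat FR FE FV (pt y) \<phi>" using sat_filtration[OF p assms(2)] by simp
  then have "refuted points FR FE \<phi>"
    unfolding refuted_def using p by (intro exI[of _ FV] exI[of _ "pt y"]) (auto simp: FV_def)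
  moreover have "two_frame points FR FE"
    using p FE_equiv by (auto simp: two_frame_def FR_def)
  ultimately show ?thesis
    using nat_frame finite_points FR_refl FR_trans FR_antisym F_commute by blast
qed

end

section \<open>The canonical model of MGrzB\<close>

instance modality :: countable
  by countable_datatype

instance fm :: countable
  by countable_datatype

lemma lang_UNIV: "\<phi> \<in> lang UNIV"
  by (induction \<phi>) (auto intro: lang.intros)

lemma MGrzB_subst: "\<phi> \<in> MGrzB \<Longrightarrow> subst \<sigma> \<phi> \<in> MGrzB"
  unfolding MGrzB_def by (rule logic_closure.substitution[OF _ lang_UNIV])

lemma unimodal_subset: "Grz \<subseteq> MGrzB" "S5 \<subseteq> MGrzB"
  unfolding MGrzB_def Grz_S5_fusion_def by (auto intro: logic_closure.base)

lemma K_logic_subset: "K_logic m \<subseteq> MGrzB"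
proof (cases m)
  case MDia
  then have "K_logic m \<subseteq> Grz" unfolding Grz_def by (auto intro: logic_closure.base)
  then show ?thesis using unimodal_subset by blast
next
  case MEx
  then have "K_logic m \<subseteq> S5" unfolding S5_def by (auto intro: logic_closure.base)
  then show ?thesis using unimodal_subset by blast
qed

text \<open>\<open>K_logic\<close> only contains unimodal tautologies. A bimodal one is a substitution instance of
  the purely propositional tautology in which each atom \<open>a\<close> is replaced by the variable with
  number \<open>to_nat a\<close>.\<close>
fun flatten :: "fm \<Rightarrow> fm" where
  "flatten (Var n) = Var (to_nat (Var n))"
| "flatten Bot = Bot"
| "flatten (Imp \<phi> \<psi>) = Imp (flatten \<phi>) (flatten \<psi>)"
| "flatten (Poss m \<phi>) = Var (to_nat (Poss m \<phi>))"

lemma subst_flatten: "subst from_nat (flatten \<phi>) = \<phi>"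
  by (induction \<phi>) auto

lemma flatten_lang: "flatten \<phi> \<in> lang M"
  by (induction \<phi>) (auto intro: lang.intros)

lemma prop_eval_flatten: "prop_eval v (flatten \<phi>) = prop_eval (\<lambda>a. v (Var (to_nat a))) \<phi>"
  by (induction \<phi>) auto

lemma MGrzB_tautology:
  assumes "tautology \<phi>"
  shows "\<phi> \<in> MGrzB"
proof -
  have "tautology (flatten \<phi>)" using assms by (simp add: tautology_def prop_eval_flatten)
  \<comment> \<open>\<open>flatten \<phi>\<close> contains no modality, so it lies in every unimodal
    language.\<close>
  then have "flatten \<phi> \<in> K_logic MDia"
    unfolding K_logic_def using flatten_lang by (auto intro: logic_closure.base)
  then have "subst from_nat (flatten \<phi>) \<in> MGrzB" using K_logic_subset by (blast intro: MGrzB_subst)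
  then show ?thesis by (simp add: subst_flatten)
qed

interpretation MGrzB: normal_logic MGrzB
proof
  show "tautology \<phi> \<Longrightarrow> \<phi> \<in> MGrzB" for \<phi> by (rule MGrzB_tautology)
  show "Imp \<phi> \<psi> \<in> MGrzB \<Longrightarrow> \<phi> \<in> MGrzB \<Longrightarrow> \<psi> \<in> MGrzB" for \<phi> \<psi>
    unfolding MGrzB_def by (rule logic_closure.mp)
  show "\<phi> \<in> MGrzB \<Longrightarrow> Nec m \<phi> \<in> MGrzB" for \<phi> m
    unfolding MGrzB_def by (rule logic_closure.necessitation) auto
  show "Imp (Nec m (Imp \<phi> \<psi>)) (Imp (Nec m \<phi>) (Nec m \<psi>)) \<in> MGrzB" for m \<phi> \<psi>
  proof -
    have "Imp (Nec m (Imp var_p var_q)) (Imp (Nec m var_p) (Nec m var_q)) \<in> K_logic m"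
      unfolding K_logic_def by (auto intro: logic_closure.base)
    from MGrzB_subst[OF subsetD[OF K_logic_subset this], of "\<lambda>n. if n = 0 then \<phi> else \<psi>"]
    show ?thesis by simp
  qed
  show "Iff (Poss m \<phi>) (Neg (Nec m (Neg \<phi>))) \<in> MGrzB" for m \<phi>
  proof -
    have "Iff (Poss m var_p) (Neg (Nec m (Neg var_p))) \<in> K_logic m"
      unfolding K_logic_def by (auto intro: logic_closure.base)
    from MGrzB_subst[OF subsetD[OF K_logic_subset this], of "\<lambda>_. \<phi>"]
    show ?thesis by simp
  qed
qed

lemma MGrzB_instances:
  shows MGrzB_grz: "Imp (Box (Imp (Box (Imp \<phi> (Box \<phi>))) \<phi>)) \<phi> \<in> MGrzB"
    and MGrzB_T: "Imp (Forall \<phi>) \<phi> \<in> MGrzB"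
    and MGrzB_4: "Imp (Forall \<phi>) (Forall (Forall \<phi>)) \<in> MGrzB"
    and MGrzB_5: "Imp (Exists \<phi>) (Forall (Exists \<phi>)) \<in> MGrzB"
    and MGrzB_ED: "Imp (Exists (Dia \<phi>)) (Dia (Exists \<phi>)) \<in> MGrzB"
    and MGrzB_DE: "Imp (Dia (Exists \<phi>)) (Exists (Dia \<phi>)) \<in> MGrzB"
proof -
  have inst: "subst (\<lambda>_. \<phi>) \<alpha> \<in> MGrzB" if "\<alpha> \<in> MGrzB" for \<alpha> using that by (rule MGrzB_subst)
  have "Imp (Box (Imp (Box (Imp var_p (Box var_p))) var_p)) var_p \<in> Grz"
    unfolding Grz_def by (rule logic_closure.base) simp
  from inst[OF subsetD[OF unimodal_subset(1) this]]
  show "Imp (Box (Imp (Box (Imp \<phi> (Box \<phi>))) \<phi>)) \<phi> \<in> MGrzB" by simp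
  have "Imp (Forall var_p) var_p \<in> S5" unfolding S5_def by (rule logic_closure.base) simp
  from inst[OF subsetD[OF unimodal_subset(2) this]] show "Imp (Forall \<phi>) \<phi> \<in> MGrzB" by simp
  have "Imp (Forall var_p) (Forall (Forall var_p)) \<in> S5" unfolding S5_def by (rule logic_closure.base) simp
  from inst[OF subsetD[OF unimodal_subset(2) this]]
  show "Imp (Forall \<phi>) (Forall (Forall \<phi>)) \<in> MGrzB" by simp
  have "Imp (Exists var_p) (Forall (Exists var_p)) \<in> S5" unfolding S5_def by (rule logic_closure.base) simp
  from inst[OF subsetD[OF unimodal_subset(2) this]]
  show "Imp (Exists \<phi>) (Forall (Exists \<phi>)) \<in> MGrzB" by simp
  have "Imp (Exists (Dia var_p)) (Dia (Exists var_p)) \<in> MGrzB"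
    unfolding MGrzB_def by (rule logic_closure.base) simp
  from inst[OF this] show "Imp (Exists (Dia \<phi>)) (Dia (Exists \<phi>)) \<in> MGrzB" by simp
  have "Imp (Dia (Exists var_p)) (Exists (Dia var_p)) \<in> MGrzB"
    unfolding MGrzB_def by (rule logic_closure.base) simp
  from inst[OF this] show "Imp (Dia (Exists \<phi>)) (Exists (Dia \<phi>)) \<in> MGrzB" by simp
qed

section \<open>Properties of the canonical relations of \<open>MGrzB\<close>\<close>

lemma MGrzB_mcs_grz:
  assumes "MGrzB.mcs x" "Box (Imp (Box (Imp \<phi> (Box \<phi>))) \<phi>) \<in> x"
  shows "\<phi> \<in> x"
  using MGrzB.mcs_theorem[OF assms(1) MGrzB_grz[of \<phi>]] MGrzB.mcs_Imp[OF assms(1), of "Box _" \<phi>] assms(2)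
  by blast

text \<open>If \<open>Box \<phi> \<in> x\<close>, every successor of \<open>x\<close> contains
  \<open>\<phi>\<close>, so the premise of Grz holds trivially and Grz yields \<open>\<phi>\<close>
  at \<open>x\<close>.\<close>

lemma MGrzB_mcs_Dia_refl:
  assumes x: "MGrzB.mcs x" "Box \<phi> \<in> x"
  shows "\<phi> \<in> x"
proof (rule MGrzB_mcs_grz[OF x(1)])
  have "Imp (Box (Imp \<phi> (Box \<phi>))) \<phi> \<in> y" if "(x, y) \<in> MGrzB.canon MDia" for y
  proof -
    have "MGrzB.mcs y" "\<phi> \<in> y" using that x MGrzB.mcs_Nec[OF x(1)] by (auto simp: MGrzB.canon_def)
    then show ?thesis using MGrzB.mcs_Imp by blast
  qed
  then show "Box (Imp (Box (Imp \<phi> (Box \<phi>))) \<phi>) \<in> x" using MGrzB.mcs_Nec[OF x(1)] by blast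
qed

text \<open>Transitivity comes from the instance of the Grz axiom at \<open>p \<and> (\<box>p \<rightarrow> \<box>\<box>p)\<close>.\<close>
lemma MGrzB_mcs_Dia_trans:
  assumes x: "MGrzB.mcs x" "Box \<phi> \<in> x"
  shows "Box (Box \<phi>) \<in> x"
proof -
  let ?\<psi> = "Conj \<phi> (Imp (Box \<phi>) (Box (Box \<phi>)))"
  have \<psi>: "?\<psi> \<in> y \<longleftrightarrow> \<phi> \<in> y \<and> (Box \<phi> \<in> y \<longrightarrow> Box (Box \<phi>) \<in> y)" if "MGrzB.mcs y" for y
    using MGrzB.mcs_Imp[OF that, of "Imp _ (Neg _)"] MGrzB.mcs_Imp[OF that, of \<phi>]
      MGrzB.mcs_Imp[OF that, of "Imp _ _" Bot] MGrzB.mcs_Imp[OF that, of "Box \<phi>"]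
      MGrzB.mcs_Bot[OF that] by blast
  have "Imp (Box (Imp ?\<psi> (Box ?\<psi>))) ?\<psi> \<in> y" if xy: "(x, y) \<in> MGrzB.canon MDia" for y
  proof -
    have y: "MGrzB.mcs y" using xy by (simp add: MGrzB.canon_def)
    have "\<phi> \<in> y" using xy MGrzB.mcs_Nec[OF x(1)] x(2) by blast
    moreover have "Box (Box \<phi>) \<in> y" if h: "Box (Imp ?\<psi> (Box ?\<psi>)) \<in> y" "Box \<phi> \<in> y"
    proof (subst MGrzB.mcs_Nec[OF y], intro allI impI)
      fix z assume yz: "(y, z) \<in> MGrzB.canon MDia"
      then have z: "MGrzB.mcs z" by (simp add: MGrzB.canon_def)
      \<comment> \<open>Otherwise \<open>?\<psi>\<close> holds at \<open>z\<close> because its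
        implication is vacuous there; then \<open>Box ?\<psi>\<close> holds at \<open>z\<close>, and
        with it \<open>Box \<phi>\<close>.\<close>
      show "Box \<phi> \<in> z"
      proof (rule ccontr)
        assume "Box \<phi> \<notin> z"
        moreover have "\<phi> \<in> z" using MGrzB.mcs_Nec[OF y] h(2) yz by blast
        ultimately have "?\<psi> \<in> z" using \<psi>[OF z] by blast
        moreover have "Imp ?\<psi> (Box ?\<psi>) \<in> z" using MGrzB.mcs_Nec[OF y] h(1) yz by blast
        ultimately have "Box ?\<psi> \<in> z" using MGrzB.mcs_Imp[OF z, of ?\<psi>] by blast
        then have "\<phi> \<in> w" if "(z, w) \<in> MGrzB.canon MDia" for w
          using that MGrzB.mcs_Nec[OF z, of MDia ?\<psi>] \<psi>[of w] unfolding MGrzB.canon_def by blast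
        then have "Box \<phi> \<in> z" using MGrzB.mcs_Nec[OF z] by blast
        then show False using \<open>Box \<phi> \<notin> z\<close> by blast
      qed
    qed
    ultimately show ?thesis using MGrzB.mcs_Imp[OF y, of "Box _" ?\<psi>] \<psi>[OF y] by blast
  qed
  then have "Box (Imp (Box (Imp ?\<psi> (Box ?\<psi>))) ?\<psi>) \<in> x" using MGrzB.mcs_Nec[OF x(1)] by blast
  then have "?\<psi> \<in> x" by (rule MGrzB_mcs_grz[OF x(1)])
  then show ?thesis using \<psi>[OF x(1)] x(2) by blast
qed

text \<open>Symmetry takes T and 5 together: T leads from \<open>\<phi>\<close> to
  \<open>Exists \<phi>\<close> at \<open>x\<close>, and 5 carries \<open>Exists \<phi>\<close> over
  to \<open>y\<close>.\<close>

lemma MGrzB_canon_equiv: "equiv {x. MGrzB.mcs x} (MGrzB.canon MEx)"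
proof (rule equivI)
  show "MGrzB.canon MEx \<subseteq> {x. MGrzB.mcs x} \<times> {x. MGrzB.mcs x}" by (auto simp: MGrzB.canon_def)
  show "refl_on {x. MGrzB.mcs x} (MGrzB.canon MEx)"
    by (auto simp: refl_on_def MGrzB.canon_refl[OF MGrzB_T])
  show "sym (MGrzB.canon MEx)"
  proof (rule symI)
    fix x y assume xy: "(x, y) \<in> MGrzB.canon MEx"
    then have x: "MGrzB.mcs x" and y: "MGrzB.mcs y" by (auto simp: MGrzB.canon_def)
    have "Exists \<phi> \<in> y" if "\<phi> \<in> x" for \<phi>
    proof -
      have "Exists \<phi> \<in> x" using that MGrzB.canon_refl[OF MGrzB_T x] by (simp add: MGrzB.canon_def)
      then have "Forall (Exists \<phi>) \<in> x"
        using MGrzB.mcs_theorem[OF x MGrzB_5[of \<phi>]] MGrzB.mcs_Imp[OF x, of "Exists \<phi>"] by blast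
      then show ?thesis using MGrzB.mcs_Nec[OF x] xy by blast
    qed
    then show "(y, x) \<in> MGrzB.canon MEx" using x y by (simp add: MGrzB.canon_def)
  qed
  show "trans (MGrzB.canon MEx)"
  proof (rule MGrzB.canon_trans)
    fix \<phi> x assume "MGrzB.mcs x" "Forall \<phi> \<in> x"
    then show "Forall (Forall \<phi>) \<in> x"
      using MGrzB.mcs_theorem[OF _ MGrzB_4[of \<phi>]] MGrzB.mcs_Imp[of x "Forall \<phi>"] by blast
  qed
qed

lemma MGrzB_canon_Dia_refl:
  assumes x: "MGrzB.mcs x"
  shows "(x, x) \<in> MGrzB.canon MDia"
proof -
  have "Dia \<phi> \<in> x" if "\<phi> \<in> x" for \<phi>
    using that MGrzB_mcs_Dia_refl[OF x, of "Neg \<phi>"] MGrzB.mcs_dual[OF x, of MDia \<phi>]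
      MGrzB.mcs_Imp[OF x, of \<phi> Bot] MGrzB.mcs_Bot[OF x] by blast
  then show ?thesis using x by (simp add: MGrzB.canon_def)
qed

interpretation MGrzB_canonical:
  commuting_grz_model "{x. MGrzB.mcs x}" "MGrzB.canon MDia" "MGrzB.canon MEx"
proof
  show "Imp (Box (Imp (Box (Imp \<phi> (Box \<phi>))) \<phi>)) \<phi> \<in> x" if "x \<in> {x. MGrzB.mcs x}" for x \<phi>
    using that MGrzB.mcs_theorem MGrzB_grz by blast
  show "MGrzB.canon MEx O MGrzB.canon MDia = MGrzB.canon MDia O MGrzB.canon MEx"
    using MGrzB.canon_commute[OF MGrzB_ED] MGrzB.canon_commute[OF MGrzB_DE] by (rule equalityI)
  show "MGrzB.canon MDia \<subseteq> {x. MGrzB.mcs x} \<times> {x. MGrzB.mcs x}" by (auto simp: MGrzB.canon_def)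
  show "trans (MGrzB.canon MDia)" by (rule MGrzB.canon_trans[OF MGrzB_mcs_Dia_trans])
qed (simp_all only: mem_Collect_eq MGrzB.mcs_Bot MGrzB.mcs_Imp MGrzB.mcs_Poss MGrzB_canon_equiv
    MGrzB_canon_Dia_refl not_False_eq_True)

section \<open>Subformulas and the finite model property\<close>

fun subformulas :: "fm \<Rightarrow> fm set" where
  "subformulas (Var n) = {Var n}"
| "subformulas Bot = {Bot}"
| "subformulas (Imp \<phi> \<psi>) = insert (Imp \<phi> \<psi>) (subformulas \<phi> \<union> subformulas \<psi>)"
| "subformulas (Poss m \<phi>) = insert (Poss m \<phi>) (subformulas \<phi>)"

lemma subformulas_refl: "\<phi> \<in> subformulas \<phi>"
  by (cases \<phi>) auto

lemma subformulas_Imp: "Imp \<alpha> \<beta> \<in> subformulas \<phi> \<Longrightarrow> \<alpha> \<in> subformulas \<phi> \<and> \<beta> \<in> subformulas \<phi>"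
  by (induction \<phi>) (auto simp: subformulas_refl)

lemma subformulas_Poss: "Poss m \<alpha> \<in> subformulas \<phi> \<Longrightarrow> \<alpha> \<in> subformulas \<phi>"
  by (induction \<phi>) (auto simp: subformulas_refl)

theorem theorem5p1:
  shows "finite_model_property MGrzB"
  unfolding finite_model_property_def
proof (intro allI impI)
  fix \<phi> assume "\<phi> \<notin> MGrzB"
  then obtain x where x: "x \<in> {x. MGrzB.mcs x}" "\<phi> \<notin> x" using MGrzB.mcs_refutes by blast
  have "finite (subformulas \<phi>)" by (induction \<phi>) auto
  then interpret filtration "{x. MGrzB.mcs x}" "MGrzB.canon MDia" "MGrzB.canon MEx" "subformulas \<phi>"
    using subformulas_Imp subformulas_Poss by unfold_locales blast+
  show "\<exists>(X :: nat set) R E. finite X \<and> logic_frame MGrzB X R E \<and> refuted X R E \<phi>"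
    using x(1) subformulas_refl x(2) by (rule finite_refutation)
qed

end
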